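(* Let $X$ and $Y$ be two (real, non-trivial) Banach spaces such that both duals $X^*$ and $Y^*$ have the weak operator Daugavet property (WODP). Then the injective tensor product $X\widehat{\otimes}_\varepsilon Y$ has the Daugavet property.
   Context: All Banach spaces are real and non-trivial (i.e. $\neq\{0\}$). $B_Z$ and $S_Z$ denote the closed unit ball and the unit sphere of a Banach space $Z$, and $Z^*$ its topological dual. Slice of $B_Z$: a set of the form $\{z\in B_Z: z^*(z)>\sup z^*(B_Z)-\alpha\}$ with $z^*\in Z^*$ and $\alpha>0$. WODP: a Banach space $Z$ has the weak operator Daugavet property (WODP) if for all $n\in\mathbb N$, $z_1,\ldots,z_n\in S_Z$, every $\varepsilon>0$, every slice $S$ of $B_Z$ and every $z'\in B_Z$ there exist $z\in S$ and a bounded linear operator $T:Z\to Z$ with $\|T\|\leq 1+\varepsilon$, $\|T(z_i)-z_i\|<\varepsilon$ for every $i\in\{1,\ldots,n\}$, and $\|T(z)-z'\|<\varepsilon$. Daugavet property: a Banach space $Z$ has the Daugavet property if $\|T+I\|=1+\|T\|$ for every rank-one bounded linear operator $T:Z\to Z$, where $I$ is the identity operator on $Z$. Injective tensor product: $X\widehat{\otimes}_\varepsilon Y$ is the completion of the algebraic tensor product $X\otimes Y$ under the norm $\|u\|_\varepsilon=\sup\{|\sum_{i=1}^n x^*(x_i)y^*(y_i)|: x^*\in S_{X^*},\ y^*\in S_{Y^*}\}$ for $u=\sum_{i=1}^n x_i\otimes y_i$. *)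

theory Defs
  imports "HOL-Analysis.Analysis"
begin

text \<open>
  Banach spaces are types of class \<open>banach\<close>. Since this class contains the zero space,
  non-triviality is stated separately. The dual of \<open>'a\<close> is the type
  \<open>'a \<Rightarrow>\<^sub>L real\<close> with the operator norm.
\<close>

definition nontrivial_space :: "'z::real_normed_vector itself \<Rightarrow> bool" where
  "nontrivial_space _ \<longleftrightarrow> (\<exists>z::'z. z \<noteq> 0)"

definition ball_slice :: "('z::real_normed_vector \<Rightarrow>\<^sub>L real) \<Rightarrow> real \<Rightarrow> 'z set" where
  "ball_slice f \<alpha> = {z \<in> cball 0 1. blinfun_apply f z > (SUP w\<in>cball 0 1. blinfun_apply f w) - \<alpha>}"

definition weak_operator_daugavet_property :: "'z::banach itself \<Rightarrow> bool" where
  "weak_operator_daugavet_property _ \<longleftrightarrow>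
    (\<forall>(n::nat) (u :: nat \<Rightarrow> 'z) (\<epsilon>::real) (f :: 'z \<Rightarrow>\<^sub>L real) (\<alpha>::real) (z'::'z).
      (\<forall>i\<in>{1..n}. u i \<in> sphere 0 1) \<and> \<epsilon> > 0 \<and> \<alpha> > 0 \<and> z' \<in> cball 0 1 \<longrightarrow>
      (\<exists>z \<in> ball_slice f \<alpha>. \<exists>T :: 'z \<Rightarrow>\<^sub>L 'z.
        norm T \<le> 1 + \<epsilon> \<and>
        (\<forall>i\<in>{1..n}. norm (blinfun_apply T (u i) - u i) < \<epsilon>) \<and>
        norm (blinfun_apply T z - z') < \<epsilon>))"

text \<open>
  Rank-one operators are those with one-dimensional range; \<open>dim\<close> is \<open>0\<close> on infinite-dimensional
  subspaces, so \<open>dim S = 1\<close> holds for the one-dimensional subspaces only.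
\<close>

definition daugavet_property :: "'z::banach itself \<Rightarrow> bool" where
  "daugavet_property _ \<longleftrightarrow>
    (\<forall>T :: 'z \<Rightarrow>\<^sub>L 'z. dim (range (blinfun_apply T)) = 1 \<longrightarrow>
      norm (T + id_blinfun) = 1 + norm T)"

text \<open>
  Algebraic tensor products and completions are determined up to (isometric) isomorphism,
  so both are described by what characterises them. \<open>tensor_map t\<close> says that the linear span of
  the vectors \<open>t x y\<close>, together with \<open>t\<close>, is an algebraic tensor product of \<open>'a\<close> and \<open>'b\<close>:
  \<open>t\<close> is bilinear and every bilinear map factors linearly through it. It is enough to factor
  real-valued maps, as linear forms separate the points of any real vector space, and it makes
  no difference that the linear form is defined on all of \<open>'z\<close>, as linear forms extend from
  subspaces.
\<close>

definition tensor_map ::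
    "('a::real_vector \<Rightarrow> 'b::real_vector \<Rightarrow> 'z::real_vector) \<Rightarrow> bool" where
  "tensor_map t \<longleftrightarrow> bilinear t \<and>
    (\<forall>B :: 'a \<Rightarrow> 'b \<Rightarrow> real. bilinear B \<longrightarrow>
      (\<exists>L :: 'z \<Rightarrow> real. linear L \<and> (\<forall>x y. L (t x y) = B x y)))"

text \<open>The injective norm of the tensor \<open>x 1 \<otimes> y 1 + \<dots> + x n \<otimes> y n\<close>.\<close>

definition injective_norm ::
    "nat \<Rightarrow> (nat \<Rightarrow> 'a::real_normed_vector) \<Rightarrow> (nat \<Rightarrow> 'b::real_normed_vector) \<Rightarrow> real" where
  "injective_norm n x y =
    (SUP (f, g) \<in> sphere (0 :: 'a \<Rightarrow>\<^sub>L real) 1 \<times> sphere (0 :: 'b \<Rightarrow>\<^sub>L real) 1.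
      \<bar>\<Sum>i=1..n. blinfun_apply f (x i) * blinfun_apply g (y i)\<bar>)"

text \<open>
  The Banach space \<open>'z\<close>, with \<open>t x y\<close> in the role of \<open>x \<otimes> y\<close>, is the completion of the
  algebraic tensor product of \<open>'a\<close> and \<open>'b\<close> under the injective norm: it is complete and
  contains the algebraic tensor product isometrically as a dense subspace. Existence of
  such a space is shown at the end of this theory.
\<close>

definition injective_tensor_product ::
    "('a::banach \<Rightarrow> 'b::banach \<Rightarrow> 'z::banach) \<Rightarrow> bool" where
  "injective_tensor_product t \<longleftrightarrow>
    tensor_map t \<and>
    (\<forall>n x y. norm (\<Sum>i=1..n. t (x i) (y i)) = injective_norm n x y) \<and>
    closure (span {t x y | x y. True}) = UNIV"


section \<open>Bounded functionals separate points\<close>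

text \<open>Hahn-Banach, by taking a minimal sublinear functional below the norm.\<close>

definition sublin :: "('a::real_normed_vector \<Rightarrow> real) \<Rightarrow> bool" where
  "sublin q \<longleftrightarrow> (\<forall>x y. q (x + y) \<le> q x + q y) \<and> (\<forall>c x. c > 0 \<longrightarrow> q (c *\<^sub>R x) = c * q x)
     \<and> (\<forall>x. q x \<le> norm x)"

lemma sublinD:
  assumes "sublin q"
  shows "q (x + y) \<le> q x + q y" "c > 0 \<Longrightarrow> q (c *\<^sub>R x) = c * q x" "q x \<le> norm x" "q 0 = 0"
    "- norm x \<le> q x" "- q (- x) \<le> q x" "c \<ge> 0 \<Longrightarrow> q (c *\<^sub>R x) = c * q x"
proof -
  show add: "q (x + y) \<le> q x + q y" for x y using assms by (auto simp: sublin_def)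
  show sc: "c > 0 \<Longrightarrow> q (c *\<^sub>R x) = c * q x" for c x using assms by (auto simp: sublin_def)
  show le: "q x \<le> norm x" for x using assms by (auto simp: sublin_def)
  have "q (2 *\<^sub>R 0) = 2 * q 0" by (rule sc) simp
  then show z: "q 0 = 0" by simp
  show neg: "- q (- x) \<le> q x" using add[of x "-x"] z by simp
  show "- norm x \<le> q x" using neg le[of "-x"] by simp
  show "c \<ge> 0 \<Longrightarrow> q (c *\<^sub>R x) = c * q x"
    using sc z by (cases "c = 0") auto
qed

lemma sublin_inf:
  fixes Q :: "('a::real_normed_vector \<Rightarrow> real) set"
  assumes ne: "Q \<noteq> {}" and sub: "\<And>q. q \<in> Q \<Longrightarrow> sublin q"
    and chain: "\<And>p q. p \<in> Q \<Longrightarrow> q \<in> Q \<Longrightarrow> p \<le> q \<or> q \<le> p"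
  shows "sublin (\<lambda>x. INF q\<in>Q. q x)" "\<And>q x. q \<in> Q \<Longrightarrow> (INF q\<in>Q. q x) \<le> q x"
proof -
  have bdd: "bdd_below ((\<lambda>q. q x) ` Q)" for x
    using sublinD(5)[OF sub] by (auto intro!: bdd_belowI[of _ "- norm x"])
  show low: "(INF q\<in>Q. q x) \<le> q x" if "q \<in> Q" for q x
    by (rule cINF_lower[OF bdd that])
  obtain q0 where q0: "q0 \<in> Q" using ne by blast
  show "sublin (\<lambda>x. INF q\<in>Q. q x)"
    unfolding sublin_def
  proof (intro conjI allI impI)
    fix x y :: 'a
    have *: "(INF q\<in>Q. q (x + y)) \<le> p x + q y" if pq: "p \<in> Q" "q \<in> Q" for p q
    proof -
      obtain r where r: "r \<in> Q" "r \<le> p" "r \<le> q" using chain[OF pq] pq by blast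
      have "(INF q\<in>Q. q (x + y)) \<le> r (x + y)" by (rule low[OF r(1)])
      also have "\<dots> \<le> r x + r y" by (rule sublinD(1)[OF sub[OF r(1)]])
      also have "\<dots> \<le> p x + q y" using r by (auto simp: le_fun_def intro: add_mono)
      finally show ?thesis .
    qed
    have "(INF q\<in>Q. q (x + y)) - q y \<le> (INF p\<in>Q. p x)" if "q \<in> Q" for q
      using *[OF _ that] by (intro cINF_greatest[OF ne]) (simp add: algebra_simps)
    then have "(INF q\<in>Q. q (x + y)) - (INF p\<in>Q. p x) \<le> (INF q\<in>Q. q y)"
      by (intro cINF_greatest[OF ne]) (simp add: algebra_simps)
    then show "(INF q\<in>Q. q (x + y)) \<le> (INF q\<in>Q. q x) + (INF q\<in>Q. q y)" by simp
  next
    fix c :: real and x :: 'a assume c: "c > 0"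
    have eq: "q (c *\<^sub>R x) = c * q x" if "q \<in> Q" for q by (rule sublinD(2)[OF sub[OF that] c])
    show "(INF q\<in>Q. q (c *\<^sub>R x)) = c * (INF q\<in>Q. q x)"
    proof (rule antisym)
      have "(INF q\<in>Q. q (c *\<^sub>R x)) / c \<le> (INF q\<in>Q. q x)"
        using low[of _ "c *\<^sub>R x"] eq c
        by (intro cINF_greatest[OF ne]) (simp add: field_simps)
      then show "(INF q\<in>Q. q (c *\<^sub>R x)) \<le> c * (INF q\<in>Q. q x)" using c by (simp add: field_simps)
      show "c * (INF q\<in>Q. q x) \<le> (INF q\<in>Q. q (c *\<^sub>R x))"
      proof (rule cINF_greatest[OF ne])
        fix q assume "q \<in> Q"
        then show "c * (INF q\<in>Q. q x) \<le> q (c *\<^sub>R x)"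
          using low[of q x] eq[of q] c by simp
      qed
    qed
  next
    fix x :: 'a
    show "(INF q\<in>Q. q x) \<le> norm x" using low[OF q0] sublinD(3)[OF sub[OF q0]] order_trans by blast
  qed
qed

lemma sublin_shift:
  fixes q :: "'a::real_normed_vector \<Rightarrow> real"
  assumes q: "sublin q"
  shows "\<exists>p. sublin p \<and> p \<le> q \<and> p (- x) \<le> - q x"
proof -
  define p where "p y = (INF t\<in>{0..}. q (y + t *\<^sub>R x) - t * q x)" for y
  have lb: "- q (- y) \<le> q (y + t *\<^sub>R x) - t * q x" if "t \<ge> 0" for y t
  proof -
    have "q (t *\<^sub>R x) \<le> q (y + t *\<^sub>R x) + q (- y)"
      using sublinD(1)[OF q, of "y + t *\<^sub>R x" "- y"] by simp
    then show ?thesis using sublinD(7)[OF q that, of x] by simp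
  qed
  have low: "p y \<le> q (y + t *\<^sub>R x) - t * q x" if "t \<ge> 0" for y t
    unfolding p_def using that lb
    by (intro cINF_lower) (auto intro!: bdd_belowI[of _ "- q (- y)"])
  have great: "m \<le> p y" if "\<And>t. t \<ge> 0 \<Longrightarrow> m \<le> q (y + t *\<^sub>R x) - t * q x" for m y
    unfolding p_def using that by (intro cINF_greatest) auto
  have pq: "p y \<le> q y" for y using low[of 0 y] by simp
  have "sublin p"
    unfolding sublin_def
  proof (intro conjI allI impI)
    fix y z :: 'a
    have *: "p (y + z) \<le> (q (y + s *\<^sub>R x) - s * q x) + (q (z + t *\<^sub>R x) - t * q x)"
      if "s \<ge> 0" "t \<ge> 0" for s t
    proof -
      have "p (y + z) \<le> q ((y + z) + (s + t) *\<^sub>R x) - (s + t) * q x" using that by (intro low) simp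
      moreover have "q ((y + z) + (s + t) *\<^sub>R x) \<le> q (y + s *\<^sub>R x) + q (z + t *\<^sub>R x)"
        using sublinD(1)[OF q, of "y + s *\<^sub>R x" "z + t *\<^sub>R x"] by (simp add: algebra_simps)
      ultimately show ?thesis by (simp add: algebra_simps)
    qed
    have "p (y + z) - (q (z + t *\<^sub>R x) - t * q x) \<le> p y" if "t \<ge> 0" for t
    proof (rule great)
      fix s :: real assume "s \<ge> 0"
      then show "p (y + z) - (q (z + t *\<^sub>R x) - t * q x) \<le> q (y + s *\<^sub>R x) - s * q x"
        using *[of s t] that by linarith
    qed
    then have "p (y + z) - p y \<le> p z"
      by (intro great) (metis diff_le_eq add.commute)
    then show "p (y + z) \<le> p y + p z" by simp
  next
    have sc: "p (c *\<^sub>R y) \<le> c * p y" if c: "c > 0" for c y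
    proof -
      have "p (c *\<^sub>R y) / c \<le> p y"
      proof (rule great)
        fix t :: real assume t: "t \<ge> 0"
        have "p (c *\<^sub>R y) \<le> q (c *\<^sub>R y + (c * t) *\<^sub>R x) - (c * t) * q x" using t c by (intro low) simp
        also have "c *\<^sub>R y + (c * t) *\<^sub>R x = c *\<^sub>R (y + t *\<^sub>R x)" by (simp add: algebra_simps)
        also have "q \<dots> = c * q (y + t *\<^sub>R x)" by (rule sublinD(2)[OF q c])
        finally have "p (c *\<^sub>R y) \<le> c * (q (y + t *\<^sub>R x) - t * q x)" by (simp add: algebra_simps)
        then show "p (c *\<^sub>R y) / c \<le> q (y + t *\<^sub>R x) - t * q x"
          using c by (simp add: field_simps)
      qed
      then show ?thesis using c by (simp add: field_simps)
    qed
    fix c :: real and y :: 'a assume c: "c > 0"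
    have "p ((1 / c) *\<^sub>R (c *\<^sub>R y)) \<le> (1 / c) * p (c *\<^sub>R y)" using c by (intro sc) simp
    then have "c * p y \<le> p (c *\<^sub>R y)" using c by (simp add: field_simps)
    then show "p (c *\<^sub>R y) = c * p y" using sc[OF c, of y] by simp
  next
    fix y show "p y \<le> norm y" using pq[of y] sublinD(3)[OF q, of y] by simp
  qed
  moreover have "p (- x) \<le> - q x" using low[of 1 "- x"] sublinD(4)[OF q] by simp
  ultimately show ?thesis using pq by (auto simp: le_fun_def)
qed

lemma minimal_sublin:
  fixes p :: "'a::real_normed_vector \<Rightarrow> real"
  assumes p: "sublin p"
  shows "\<exists>q. sublin q \<and> q \<le> p \<and> (\<forall>r. sublin r \<and> r \<le> q \<longrightarrow> r = q)"
proof -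
  define A where "A = {q. sublin q \<and> q \<le> p}"
  define P where "P = (\<lambda>q r :: 'a \<Rightarrow> real. r \<le> q)"
  have "\<exists>m\<in>A. \<forall>a\<in>A. P m a \<longrightarrow> a = m"
  proof (rule predicate_Zorn)
    show "partial_order_on A (relation_of P A)"
      unfolding partial_order_on_def preorder_on_def
      by (auto simp: refl_on_def trans_def antisym_def relation_of_def P_def)
  next
    fix C assume C: "C \<in> Chains (relation_of P A)"
    then have CA: "C \<subseteq> A" by (auto simp: Chains_def relation_of_def)
    have ch: "q \<le> r \<or> r \<le> q" if "q \<in> C" "r \<in> C" for q r
      using C that by (auto simp: Chains_def relation_of_def P_def)
    show "\<exists>u\<in>A. \<forall>a\<in>C. P a u"
    proof (cases "C = {}")
      case True
      then show ?thesis using p by (auto simp: A_def)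
    next
      case False
      have s: "sublin q" if "q \<in> C" for q using CA that by (auto simp: A_def)
      note inf = sublin_inf[of C, OF False s ch]
      obtain q where q: "q \<in> C" using False by blast
      have "(\<lambda>x. INF q\<in>C. q x) \<in> A"
        unfolding A_def
      proof (intro CollectI conjI)
        show "sublin (\<lambda>x. INF q\<in>C. q x)" by (rule inf(1))
        have "(INF q\<in>C. q x) \<le> p x" for x
          using inf(2)[OF _ _ _ q, of x] q CA s ch
          by (smt (verit, best) A_def le_funD mem_Collect_eq subsetD)
        then show "(\<lambda>x. INF q\<in>C. q x) \<le> p" by (simp add: le_fun_def)
      qed
      moreover have "P a (\<lambda>x. INF q\<in>C. q x)" if "a \<in> C" for a
        using inf(2)[OF _ _ _ that] by (auto simp: P_def le_fun_def)
      ultimately show ?thesis by blast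
    qed
  qed
  then show ?thesis unfolding A_def P_def by (auto intro: order_trans)
qed

lemma functional_separates:
  fixes x :: "'a::real_normed_vector"
  assumes "x \<noteq> 0"
  shows "\<exists>f :: 'a \<Rightarrow>\<^sub>L real. blinfun_apply f x \<noteq> 0"
proof -
  have "sublin (norm :: 'a \<Rightarrow> real)" by (auto simp: sublin_def norm_triangle_ineq)
  from sublin_shift[OF this, of x] obtain p where p: "sublin p" "p (- x) \<le> - norm x" by blast
  from minimal_sublin[OF p(1)] obtain q where q: "sublin q" "q \<le> p"
    and min: "\<And>r. sublin r \<Longrightarrow> r \<le> q \<Longrightarrow> r = q" by blast
  have odd: "q (- y) = - q y" for y
  proof -
    obtain r where "sublin r" "r \<le> q" "r (- y) \<le> - q y" using sublin_shift[OF q(1)] by blast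
    then have "q (- y) \<le> - q y" using min by blast
    then show ?thesis using sublinD(6)[OF q(1), of y] by simp
  qed
  have add: "q (y + z) = q y + q z" for y z
    using sublinD(1)[OF q(1), of y z] sublinD(1)[OF q(1), of "-y" "-z"] odd[of y] odd[of z]
      odd[of "y + z"] by simp
  have sc: "q (c *\<^sub>R y) = c * q y" for c y
  proof (cases "c \<ge> 0")
    case True then show ?thesis by (rule sublinD(7)[OF q(1)])
  next
    case False
    then have "q ((- c) *\<^sub>R y) = - c * q y" by (intro sublinD(7)[OF q(1)]) simp
    then show ?thesis using odd[of "c *\<^sub>R y"] by simp
  qed
  have "bounded_linear q"
  proof (rule bounded_linear_intro[where K = 1])
    show "norm (q y) \<le> norm y * 1" for y
      using sublinD(3,5)[OF q(1), of y] by (simp add: abs_le_iff)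
  qed (auto simp: add sc)
  moreover have "q x \<noteq> 0"
  proof -
    have "q (- x) \<le> - norm x" using q(2) p(2) by (auto simp: le_fun_def intro: order_trans)
    then show ?thesis using odd[of x] assms by auto
  qed
  ultimately show ?thesis by (intro exI[of _ "Blinfun q"]) (simp add: bounded_linear_Blinfun_apply)
qed


section \<open>Existence of the injective tensor product\<close>

text \<open>\<open>x \<otimes> y\<close> as a bounded bilinear form on the product of the duals.\<close>

definition tensor_form ::
    "'a::banach \<Rightarrow> 'b::banach \<Rightarrow> ('a \<Rightarrow>\<^sub>L real) \<Rightarrow>\<^sub>L ('b \<Rightarrow>\<^sub>L real) \<Rightarrow>\<^sub>L real" where
  "tensor_form x y = Blinfun (\<lambda>f. Blinfun (\<lambda>g. blinfun_apply f x * blinfun_apply g y))"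

lemma tensor_form_apply [simp]:
  fixes x :: "'a::banach" and y :: "'b::banach"
  shows "blinfun_apply (blinfun_apply (tensor_form x y) f) g = blinfun_apply f x * blinfun_apply g y"
proof -
  have bg: "bounded_linear (\<lambda>g. blinfun_apply f x * blinfun_apply g y)"
    for f :: "'a \<Rightarrow>\<^sub>L real"
    by (rule bounded_linear_const_mult[OF blinfun.bounded_linear_left])
  have inner: "blinfun_apply (Blinfun (\<lambda>g. blinfun_apply f x * blinfun_apply g y)) g
      = blinfun_apply f x * blinfun_apply g y" for f :: "'a \<Rightarrow>\<^sub>L real" and g
    by (simp add: bounded_linear_Blinfun_apply[OF bg])
  have "bounded_linear (\<lambda>f :: 'a \<Rightarrow>\<^sub>L real. Blinfun (\<lambda>g. blinfun_apply f x * blinfun_apply g y))"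
  proof (rule bounded_linear_intro[where K = "norm x * norm y"])
    show "norm (Blinfun (\<lambda>g. blinfun_apply f x * blinfun_apply g y)) \<le> norm f * (norm x * norm y)"
      for f :: "'a \<Rightarrow>\<^sub>L real"
    proof (rule norm_blinfun_bound)
      show "norm (blinfun_apply (Blinfun (\<lambda>g. blinfun_apply f x * blinfun_apply g y)) g)
          \<le> norm f * (norm x * norm y) * norm g" for g :: "'b \<Rightarrow>\<^sub>L real"
        using mult_mono[OF norm_blinfun[of f x] norm_blinfun[of g y]]
        by (simp add: inner abs_mult mult_ac)
    qed simp
  qed (rule blinfun_eqI, subst inner, simp only: inner blinfun.add_left blinfun.scaleR_left,
      simp add: algebra_simps)+
  then show ?thesis by (simp add: tensor_form_def bounded_linear_Blinfun_apply inner)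
qed

lemma bilinear_tensor_form: "bilinear tensor_form"
  unfolding bilinear_def
  by (auto intro!: linearI blinfun_eqI
      simp: blinfun.add_left blinfun.scaleR_left blinfun.add_right blinfun.scaleR_right algebra_simps)

lemma subspace_closure_tensors: "subspace (closure (span {tensor_form x y | x y. True}))"
proof -
  have add: "(\<lambda>p. fst p + snd p) ` (closure S \<times> closure S) \<subseteq> closure S"
    if S: "subspace S" for S :: "'z::real_normed_vector set"
  proof -
    have "(\<lambda>p. fst p + snd p) ` closure (S \<times> S) \<subseteq> closure S"
      using S closure_subset[of S]
      by (intro image_closure_subset continuous_intros) (auto simp: subspace_add)
    then show ?thesis by (simp add: closure_Times)
  qed
  have mul: "(*\<^sub>R) c ` closure S \<subseteq> closure S"
    if S: "subspace S" for c and S :: "'z::real_normed_vector set"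
    using S closure_subset[of S]
    by (intro image_closure_subset continuous_intros) (auto simp: subspace_scale)
  have "subspace (closure S)" if "subspace S" for S :: "'z::real_normed_vector set"
    unfolding subspace_def
  proof (intro conjI ballI allI)
    show "0 \<in> closure S" using closure_subset[of S] subspace_0[OF that] by blast
    show "x + y \<in> closure S" if "x \<in> closure S" "y \<in> closure S" for x y
      using add[OF \<open>subspace S\<close>] that by (force simp: image_subset_iff)
    show "c *\<^sub>R x \<in> closure S" if "x \<in> closure S" for c x
      using mul[OF \<open>subspace S\<close>] that by (simp add: image_subset_iff)
  qed
  then show ?thesis using subspace_span by blast
qed

typedef (overloaded) ('a::banach, 'b::banach) inj_tensor =
  "closure (span {tensor_form (x::'a) (y::'b) | x y. True})"
  using subspace_0[OF subspace_closure_tensors] by blast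

setup_lifting type_definition_inj_tensor

instantiation inj_tensor :: (banach, banach) real_normed_vector
begin

lift_definition zero_inj_tensor :: "('a, 'b) inj_tensor" is 0
  by (rule subspace_0[OF subspace_closure_tensors])
lift_definition plus_inj_tensor ::
  "('a, 'b) inj_tensor \<Rightarrow> ('a, 'b) inj_tensor \<Rightarrow> ('a, 'b) inj_tensor" is "(+)"
  by (rule subspace_add[OF subspace_closure_tensors])
lift_definition minus_inj_tensor ::
  "('a, 'b) inj_tensor \<Rightarrow> ('a, 'b) inj_tensor \<Rightarrow> ('a, 'b) inj_tensor" is "(-)"
  by (rule subspace_diff[OF subspace_closure_tensors])
lift_definition uminus_inj_tensor :: "('a, 'b) inj_tensor \<Rightarrow> ('a, 'b) inj_tensor" is uminus
  by (rule subspace_neg[OF subspace_closure_tensors])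
lift_definition scaleR_inj_tensor :: "real \<Rightarrow> ('a, 'b) inj_tensor \<Rightarrow> ('a, 'b) inj_tensor" is scaleR
  by (rule subspace_scale[OF subspace_closure_tensors])
lift_definition norm_inj_tensor :: "('a, 'b) inj_tensor \<Rightarrow> real" is norm .

definition "dist_inj_tensor (u :: ('a, 'b) inj_tensor) v = norm (u - v)"
definition "sgn_inj_tensor (u :: ('a, 'b) inj_tensor) = inverse (norm u) *\<^sub>R u"
definition [code del]: "(uniformity :: (('a, 'b) inj_tensor \<times> ('a, 'b) inj_tensor) filter)
  = (INF e\<in>{0<..}. principal {(u, v). dist u v < e})"
definition [code del]: "open_inj_tensor (U :: ('a, 'b) inj_tensor set) \<longleftrightarrow>
  (\<forall>u\<in>U. eventually (\<lambda>(u', v). u' = u \<longrightarrow> v \<in> U) uniformity)"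

instance
proof
  fix u v w :: "('a, 'b) inj_tensor" and a b :: real
  show "dist u v = norm (u - v)" by (rule dist_inj_tensor_def)
  show "sgn u = inverse (norm u) *\<^sub>R u" by (rule sgn_inj_tensor_def)
  show "uniformity = (INF e\<in>{0<..}. principal {(u :: ('a, 'b) inj_tensor, v). dist u v < e})"
    by (rule uniformity_inj_tensor_def)
  show "open U \<longleftrightarrow> (\<forall>u\<in>U. eventually (\<lambda>(u', v). u' = u \<longrightarrow> v \<in> U) uniformity)"
    for U :: "('a, 'b) inj_tensor set" by (rule open_inj_tensor_def)
  show "u + v + w = u + (v + w)" by transfer (simp add: algebra_simps)
  show "u + v = v + u" by transfer (simp add: algebra_simps)
  show "0 + u = u" by transfer simp
  show "- u + u = 0" by transfer simp
  show "u - v = u + - v" by transfer simp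
  show "a *\<^sub>R (u + v) = a *\<^sub>R u + a *\<^sub>R v" by transfer (simp add: algebra_simps)
  show "(a + b) *\<^sub>R u = a *\<^sub>R u + b *\<^sub>R u" by transfer (simp add: algebra_simps)
  show "a *\<^sub>R b *\<^sub>R u = (a * b) *\<^sub>R u" by transfer simp
  show "1 *\<^sub>R u = u" by transfer simp
  show "norm u = 0 \<longleftrightarrow> u = 0" by transfer simp
  show "norm (u + v) \<le> norm u + norm v" by transfer (rule norm_triangle_ineq)
  show "norm (a *\<^sub>R u) = \<bar>a\<bar> * norm u" by transfer simp
qed

end

lemma dist_Rep_inj_tensor: "dist (Rep_inj_tensor u) (Rep_inj_tensor v) = dist u v"
  by (simp add: dist_norm norm_inj_tensor.rep_eq minus_inj_tensor.rep_eq)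

instance inj_tensor :: (banach, banach) banach
proof
  fix X :: "nat \<Rightarrow> ('a, 'b) inj_tensor"
  assume "Cauchy X"
  then have "Cauchy (\<lambda>n. Rep_inj_tensor (X n))"
    by (simp add: Cauchy_def dist_Rep_inj_tensor)
  then obtain l where l: "(\<lambda>n. Rep_inj_tensor (X n)) \<longlonglongrightarrow> l"
    using Cauchy_convergent convergent_def by blast
  have "l \<in> closure (span {tensor_form (x::'a) (y::'b) | x y. True})"
    by (rule closed_sequentially[OF closed_closure _ l]) (rule Rep_inj_tensor)
  then have "Rep_inj_tensor (Abs_inj_tensor l) = l" by (rule Abs_inj_tensor_inverse)
  then have "X \<longlonglongrightarrow> Abs_inj_tensor l"
    using l by (metis (no_types, lifting) dist_Rep_inj_tensor lim_sequentially)
  then show "convergent X" by (auto simp: convergent_def)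
qed

lift_definition inj_tensor :: "'a::banach \<Rightarrow> 'b::banach \<Rightarrow> ('a, 'b) inj_tensor" is tensor_form
  by (rule subsetD[OF closure_subset], rule span_base, blast)

lemma linear_Rep_inj_tensor: "linear Rep_inj_tensor"
  by (intro linearI) (simp_all add: plus_inj_tensor.rep_eq scaleR_inj_tensor.rep_eq)

lemma bilinear_inj_tensor: "bilinear inj_tensor"
  unfolding bilinear_def
  by (auto intro!: linearI; transfer;
      simp add: bilinear_ladd[OF bilinear_tensor_form] bilinear_radd[OF bilinear_tensor_form]
        bilinear_lmul[OF bilinear_tensor_form] bilinear_rmul[OF bilinear_tensor_form])

lemma separated_coefficients:
  fixes S :: "'a::banach set"
  assumes "independent S" "finite S"
    and "\<And>f :: 'a \<Rightarrow>\<^sub>L real. (\<Sum>s\<in>S. c s * blinfun_apply f s) = 0" and "s \<in> S"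
  shows "c s = 0"
proof -
  have "blinfun_apply f (\<Sum>s\<in>S. c s *\<^sub>R s) = 0" for f :: "'a \<Rightarrow>\<^sub>L real"
    using assms(3)[of f] by (simp add: blinfun.sum_right blinfun.scaleR_right)
  then have "(\<Sum>s\<in>S. c s *\<^sub>R s) = 0" using functional_separates by blast
  then show ?thesis using assms(1,2,4) independentD by blast
qed

lemma tensor_map_inj_tensor:
  "tensor_map (inj_tensor :: 'a::banach \<Rightarrow> 'b::banach \<Rightarrow> ('a, 'b) inj_tensor)"
  unfolding tensor_map_def
proof (intro conjI allI impI)
  show "bilinear (inj_tensor :: 'a \<Rightarrow> 'b \<Rightarrow> ('a, 'b) inj_tensor)" by (rule bilinear_inj_tensor)
  fix B :: "'a \<Rightarrow> 'b \<Rightarrow> real" assume B: "bilinear B"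
  obtain E :: "'a set" where E: "independent E" "span E = UNIV"
    by (rule basis_exists[of "UNIV :: 'a set"]) auto
  obtain F :: "'b set" where F: "independent F" "span F = UNIV"
    by (rule basis_exists[of "UNIV :: 'b set"]) auto
  define \<tau> where "\<tau> = (\<lambda>(e, f). inj_tensor e f :: ('a, 'b) inj_tensor)"
  have key: "c e f = 0"
    if fin: "finite E'" "finite F'" and sub: "E' \<subseteq> E" "F' \<subseteq> F" and ef: "e \<in> E'" "f \<in> F'"
      and z: "(\<Sum>p\<in>E' \<times> F'. c (fst p) (snd p) *\<^sub>R \<tau> p) = 0"
    for E' F' and c :: "'a \<Rightarrow> 'b \<Rightarrow> real" and e f
  proof -
    have indE: "independent E'" using E(1) sub(1) by (rule independent_mono)
    have indF: "independent F'" using F(1) sub(2) by (rule independent_mono)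
    have "Rep_inj_tensor (\<Sum>p\<in>E' \<times> F'. c (fst p) (snd p) *\<^sub>R \<tau> p) = 0"
      by (simp add: z zero_inj_tensor.rep_eq)
    then have "(\<Sum>p\<in>E' \<times> F'. c (fst p) (snd p) *\<^sub>R tensor_form (fst p) (snd p)) = 0"
      by (simp add: linear_sum[OF linear_Rep_inj_tensor] scaleR_inj_tensor.rep_eq \<tau>_def
          inj_tensor.rep_eq case_prod_beta)
    then have "blinfun_apply (blinfun_apply
        (\<Sum>p\<in>E' \<times> F'. c (fst p) (snd p) *\<^sub>R tensor_form (fst p) (snd p)) g) h = 0" for g h
      by simp
    then have zero: "(\<Sum>p\<in>E' \<times> F'. c (fst p) (snd p) *
        (blinfun_apply g (fst p) * blinfun_apply h (snd p))) = 0" for g h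
      by (simp add: blinfun.sum_left blinfun.scaleR_left)
    have "(\<Sum>a\<in>E'. (\<Sum>b\<in>F'. c a b * blinfun_apply h b) * blinfun_apply g a) = 0"
      for g :: "'a \<Rightarrow>\<^sub>L real" and h :: "'b \<Rightarrow>\<^sub>L real"
    proof -
      have "(\<Sum>a\<in>E'. (\<Sum>b\<in>F'. c a b * blinfun_apply h b) * blinfun_apply g a)
          = (\<Sum>a\<in>E'. \<Sum>b\<in>F'. c a b * (blinfun_apply g a * blinfun_apply h b))"
        unfolding sum_distrib_right by (intro sum.cong refl) simp
      also have "\<dots> = (\<Sum>p\<in>E' \<times> F'. c (fst p) (snd p) *
          (blinfun_apply g (fst p) * blinfun_apply h (snd p)))"
        by (simp add: sum.cartesian_product case_prod_beta)
      finally show ?thesis using zero by simp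
    qed
    from separated_coefficients[OF indE fin(1) this ef(1)]
    have "(\<Sum>b\<in>F'. c e b * blinfun_apply h b) = 0" for h :: "'b \<Rightarrow>\<^sub>L real" .
    from separated_coefficients[OF indF fin(2) this ef(2)]
    show ?thesis .
  qed
  have inj: "inj_on \<tau> (E \<times> F)"
  proof (rule inj_onI, rule ccontr)
    fix p q assume p: "p \<in> E \<times> F" and q: "q \<in> E \<times> F" and eq: "\<tau> p = \<tau> q" and ne: "p \<noteq> q"
    define E' where "E' = {fst p, fst q}"
    define F' where "F' = {snd p, snd q}"
    define c :: "'a \<Rightarrow> 'b \<Rightarrow> real"
      where "c a b = (if (a, b) = p then 1 else if (a, b) = q then - 1 else 0)" for a b
    have pq: "{p, q} \<subseteq> E' \<times> F'" by (auto simp: E'_def F'_def mem_Times_iff)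
    have "(\<Sum>r\<in>E' \<times> F'. c (fst r) (snd r) *\<^sub>R \<tau> r) = (\<Sum>r\<in>{p, q}. c (fst r) (snd r) *\<^sub>R \<tau> r)"
      by (rule sum.mono_neutral_right[OF _ pq]) (auto simp: c_def E'_def F'_def)
    also have "\<dots> = 0" using ne eq by (simp add: c_def)
    finally have "c (fst p) (snd p) = 0"
      using p q by (intro key[of E' F']) (auto simp: E'_def F'_def)
    then show False by (simp add: c_def)
  qed
  have "independent (\<tau> ` (E \<times> F))"
    unfolding independent_explicit_module
  proof (intro allI impI)
    fix T u v assume T: "finite T" "T \<subseteq> \<tau> ` (E \<times> F)" "(\<Sum>v\<in>T. u v *\<^sub>R v) = 0" "v \<in> T"
    obtain P where P: "P \<subseteq> E \<times> F" "finite P" "T = \<tau> ` P"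
      using finite_subset_image[OF T(1,2)] by metis
    obtain p where p: "p \<in> P" "v = \<tau> p" using T(4) P(3) by blast
    define c :: "'a \<Rightarrow> 'b \<Rightarrow> real" where "c a b = (if (a, b) \<in> P then u (\<tau> (a, b)) else 0)" for a b
    have sub: "P \<subseteq> fst ` P \<times> snd ` P" by force
    have "(\<Sum>r\<in>fst ` P \<times> snd ` P. c (fst r) (snd r) *\<^sub>R \<tau> r) = (\<Sum>r\<in>P. c (fst r) (snd r) *\<^sub>R \<tau> r)"
      by (rule sum.mono_neutral_right[OF _ sub]) (auto simp: c_def P(2))
    also have "\<dots> = (\<Sum>r\<in>P. u (\<tau> r) *\<^sub>R \<tau> r)" by (rule sum.cong) (auto simp: c_def)
    also have "\<dots> = (\<Sum>v\<in>T. u v *\<^sub>R v)"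
      unfolding P(3) using inj_on_subset[OF inj P(1)] by (simp add: sum.reindex)
    finally have "c (fst p) (snd p) = 0"
      using P p T(3) by (intro key[of "fst ` P" "snd ` P"]) auto
    then show "u v = 0" using p by (simp add: c_def)
  qed
  from linear_independent_extend[OF this, of "\<lambda>u. case the_inv_into (E \<times> F) \<tau> u of (e, f) \<Rightarrow> B e f"]
  obtain L :: "('a, 'b) inj_tensor \<Rightarrow> real" where L: "linear L"
    and LB: "\<forall>u\<in>\<tau> ` (E \<times> F). L u = (case the_inv_into (E \<times> F) \<tau> u of (e, f) \<Rightarrow> B e f)"
    by blast
  have LB': "L (inj_tensor e f) = B e f" if "e \<in> E" "f \<in> F" for e f
  proof -
    have "the_inv_into (E \<times> F) \<tau> (\<tau> (e, f)) = (e, f)"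
      using that by (intro the_inv_into_f_f[OF inj]) simp
    moreover have "\<tau> (e, f) \<in> \<tau> ` (E \<times> F)" using that by blast
    ultimately have "L (\<tau> (e, f)) = B e f" using bspec[OF LB, of "\<tau> (e, f)"] by simp
    then show ?thesis by (simp add: \<tau>_def)
  qed
  have "bilinear (\<lambda>x y. L (inj_tensor x y))"
    using L by (auto simp: bilinear_def linear_iff bilinear_ladd[OF bilinear_inj_tensor]
        bilinear_radd[OF bilinear_inj_tensor] bilinear_lmul[OF bilinear_inj_tensor]
        bilinear_rmul[OF bilinear_inj_tensor])
  from bilinear_eq[OF this B, of UNIV E UNIV F] LB'
  have "L (inj_tensor x y) = B x y" for x y by (simp add: E(2) F(2))
  then show "\<exists>L. linear L \<and> (\<forall>x y. L (inj_tensor x y) = B x y)" using L by blast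
qed

lemma nontrivial_dual_sphere:
  assumes "nontrivial_space TYPE('a::banach)"
  shows "\<exists>f :: 'a \<Rightarrow>\<^sub>L real. norm f = 1"
proof -
  from assms obtain x :: 'a where "x \<noteq> 0" by (auto simp: nontrivial_space_def)
  then obtain f :: "'a \<Rightarrow>\<^sub>L real" where "blinfun_apply f x \<noteq> 0" using functional_separates by blast
  then have "f \<noteq> 0" by auto
  then show ?thesis by (intro exI[of _ "sgn f"]) (simp add: norm_sgn)
qed

theorem injective_tensor_product_exists:
  assumes "nontrivial_space TYPE('a::banach)" "nontrivial_space TYPE('b::banach)"
  shows "injective_tensor_product (inj_tensor :: 'a \<Rightarrow> 'b \<Rightarrow> ('a, 'b) inj_tensor)"
  unfolding injective_tensor_product_def
proof (intro conjI allI)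
  show "tensor_map (inj_tensor :: 'a \<Rightarrow> 'b \<Rightarrow> ('a, 'b) inj_tensor)" by (rule tensor_map_inj_tensor)
next
  fix n :: nat and x :: "nat \<Rightarrow> 'a" and y :: "nat \<Rightarrow> 'b"
  define w where "w = (\<Sum>i=1..n. tensor_form (x i) (y i))"
  have w: "blinfun_apply (blinfun_apply w f) g
      = (\<Sum>i=1..n. blinfun_apply f (x i) * blinfun_apply g (y i))" for f g
    by (simp add: w_def blinfun.sum_left)
  have "norm (\<Sum>i=1..n. inj_tensor (x i) (y i)) = norm w"
    by (simp add: norm_inj_tensor.rep_eq linear_sum[OF linear_Rep_inj_tensor] inj_tensor.rep_eq w_def)
  also have "norm w = injective_norm n x y"
  proof (rule antisym)
    have le: "\<bar>blinfun_apply (blinfun_apply w f) g\<bar> \<le> norm w * norm f * norm g" for f g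
    proof -
      have "\<bar>blinfun_apply (blinfun_apply w f) g\<bar> \<le> norm (blinfun_apply w f) * norm g"
        using norm_blinfun[of "blinfun_apply w f" g] by simp
      also have "\<dots> \<le> norm w * norm f * norm g"
        by (intro mult_right_mono norm_blinfun) simp
      finally show ?thesis .
    qed
    have N: "injective_norm n x y = (SUP p \<in> sphere 0 1 \<times> sphere 0 1.
        \<bar>blinfun_apply (blinfun_apply w (fst p)) (snd p)\<bar>)"
      by (simp add: injective_norm_def w case_prod_beta)
    obtain f0 :: "'a \<Rightarrow>\<^sub>L real" and g0 :: "'b \<Rightarrow>\<^sub>L real" where "norm f0 = 1" "norm g0 = 1"
      using nontrivial_dual_sphere[OF assms(1)] nontrivial_dual_sphere[OF assms(2)] by blast
    then have mem: "(f0, g0) \<in> sphere 0 1 \<times> sphere 0 1" by simp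
    show "injective_norm n x y \<le> norm w"
      unfolding N using mem
    proof (intro cSUP_least)
      fix p :: "('a \<Rightarrow>\<^sub>L real) \<times> ('b \<Rightarrow>\<^sub>L real)" assume "p \<in> sphere 0 1 \<times> sphere 0 1"
      then show "\<bar>blinfun_apply (blinfun_apply w (fst p)) (snd p)\<bar> \<le> norm w"
        using le[of "fst p" "snd p"] by (auto simp: mem_Times_iff)
    qed auto
    have bdd: "bdd_above ((\<lambda>p. \<bar>blinfun_apply (blinfun_apply w (fst p)) (snd p)\<bar>) `
        (sphere 0 1 \<times> sphere 0 1))"
    proof (rule bdd_aboveI2)
      fix p :: "('a \<Rightarrow>\<^sub>L real) \<times> ('b \<Rightarrow>\<^sub>L real)" assume "p \<in> sphere 0 1 \<times> sphere 0 1"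
      then show "\<bar>blinfun_apply (blinfun_apply w (fst p)) (snd p)\<bar> \<le> norm w"
        using le[of "fst p" "snd p"] by (auto simp: mem_Times_iff)
    qed
    have unit: "\<bar>blinfun_apply (blinfun_apply w f) g\<bar> \<le> injective_norm n x y"
      if "norm f = 1" "norm g = 1" for f g
      unfolding N using cSUP_upper[OF _ bdd, of "(f, g)"] that by simp
    have "0 \<le> injective_norm n x y" using unit[OF \<open>norm f0 = 1\<close> \<open>norm g0 = 1\<close>] by linarith
    have all: "\<bar>blinfun_apply (blinfun_apply w f) g\<bar> \<le> injective_norm n x y * norm f * norm g" for f g
    proof (cases "f = 0 \<or> g = 0")
      case True
      then show ?thesis by auto
    next
      case False
      then have "\<bar>blinfun_apply (blinfun_apply w (sgn f)) (sgn g)\<bar> \<le> injective_norm n x y"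
        by (intro unit) (auto simp: norm_sgn)
      moreover have "blinfun_apply (blinfun_apply w (sgn f)) (sgn g)
          = blinfun_apply (blinfun_apply w f) g / (norm f * norm g)"
        by (simp add: sgn_div_norm blinfun.scaleR_left blinfun.scaleR_right field_simps)
      ultimately show ?thesis using False by (simp add: abs_mult field_simps)
    qed
    show "norm w \<le> injective_norm n x y"
      by (intro norm_blinfun_bound)
        (use \<open>0 \<le> injective_norm n x y\<close> all in auto)
  qed
  finally show "norm (\<Sum>i=1..n. inj_tensor (x i) (y i)) = injective_norm n x y" .
next
  let ?T = "{inj_tensor x y | (x::'a) (y::'b). True}"
  let ?U = "{tensor_form x y | (x::'a) (y::'b). True}"
  have im: "Rep_inj_tensor ` span ?T = span ?U"
  proof -
    have "Rep_inj_tensor ` span ?T = span (Rep_inj_tensor ` ?T)"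
      by (rule linear_span_image[OF linear_Rep_inj_tensor, symmetric])
    also have "Rep_inj_tensor ` ?T = ?U"
    proof (intro equalityI subsetI)
      show "v \<in> ?U" if v: "v \<in> Rep_inj_tensor ` ?T" for v
      proof -
        obtain x :: 'a and y :: 'b where "v = Rep_inj_tensor (inj_tensor x y)" using v by blast
        then have "v = tensor_form x y" by (simp add: inj_tensor.rep_eq)
        then show ?thesis by blast
      qed
      show "v \<in> Rep_inj_tensor ` ?T" if v: "v \<in> ?U" for v
      proof -
        obtain x :: 'a and y :: 'b where "v = tensor_form x y" using v by blast
        then have "v = Rep_inj_tensor (inj_tensor x y)" by (simp add: inj_tensor.rep_eq)
        then show ?thesis by blast
      qed
    qed
    finally show ?thesis .
  qed
  have "u \<in> closure (span ?T)" for u :: "('a, 'b) inj_tensor"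
    unfolding closure_approachable
  proof (intro allI impI)
    fix e :: real assume "e > 0"
    then obtain v where v: "v \<in> span ?U" "dist v (Rep_inj_tensor u) < e"
      using Rep_inj_tensor[of u] unfolding closure_approachable by blast
    then obtain t where "t \<in> span ?T" "v = Rep_inj_tensor t" using im by blast
    then show "\<exists>t\<in>span ?T. dist t u < e" using v(2) by (auto simp: dist_Rep_inj_tensor)
  qed
  then show "closure (span ?T) = UNIV" by blast
qed

end

theory Submission
  imports Defs
begin

text \<open>
  Write \<open>Z\<close> for the injective tensor product of \<open>X\<close> and \<open>Y\<close>, and \<open>f \<otimes> g\<close> for the functional on
  \<open>Z\<close> with \<open>(f \<otimes> g) (x \<otimes> y) = f x * g y\<close>. A rank-one operator has the form \<open>G w = \<phi> w \<cdot> z\<close> with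
  \<open>norm z = 1\<close>. If \<open>F\<close> is a functional with \<open>norm F \<le> 1\<close> and \<open>F z\<close> close to 1, the adjoint of
  \<open>G + I\<close> sends it close to \<open>\<phi> + F\<close>. So it suffices to find \<open>F = f \<otimes> g\<close> with \<open>norm f\<close>, \<open>norm g\<close>
  at most 1 that lies in the slice given by \<open>z\<close> and for which \<open>norm (\<phi> + F)\<close> is almost
  \<open>norm \<phi> + 1\<close> (\<open>elementary_functional_daugavet\<close>).

  Each requirement alone is easily met, by some \<open>f0 \<otimes> g0\<close> and some \<open>f1 \<otimes> g1\<close>, because the
  elementary functionals norm \<open>Z\<close>. The weak operator Daugavet property is used to replace
  \<open>f1\<close>, and then \<open>g1\<close>, by a functional in a prescribed slice without losing norm
  (\<open>slice_replacement\<close>). To replace \<open>f1\<close>, fix a finite sum \<open>u = \<Sum> a j \<otimes> b j\<close> nearly norming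
  \<open>\<phi> + f1 \<otimes> g1\<close> and take an operator \<open>T\<close> on the dual of \<open>X\<close>, of norm about 1, that almost fixes
  the finitely many functionals \<open>x \<mapsto> \<phi> (x \<otimes> b j)\<close> and maps some \<open>f\<close> in the slice close to
  \<open>f1\<close>. Letting \<open>T\<close> act on \<open>\<phi> + f \<otimes> g1\<close> gives a form with almost the same value at \<open>u\<close> as
  \<open>\<phi> + f1 \<otimes> g1\<close>.

  It remains to see that this action of \<open>T\<close> increases the norm by a factor of at most \<open>norm T\<close>
  (\<open>operator_on_dual_bound\<close>). This is clear for finite sums \<open>\<Sum> f k \<otimes> g k\<close> with
  \<open>\<Sum> norm (f k) * norm (g k)\<close> bounded by the norm of the form. A general form need not be a
  norm limit of such sums, but the value at \<open>u\<close> involves only the vectors \<open>b j\<close>, and on finitely many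
  vectors of \<open>Y\<close> every form is approximated by such sums (\<open>finite_projective_approximation\<close>):
  there the injective norm is nearly a maximum over finitely many functionals \<open>g k\<close>, and
  Hahn-Banach applies in \<open>\<ell>\<^sup>\<infinity>\<close> over \<open>X\<close>.
\<close>

section \<open>Hahn-Banach\<close>

text \<open>
  A sublinear functional that is minimal below \<open>q\<close> is odd, since otherwise \<open>sublin_shift\<close>
  would lower it further; an odd sublinear functional is linear.
\<close>

lemma sublinear_dominates_functional:
  fixes q :: "'e::real_normed_vector \<Rightarrow> real"
  assumes "sublin q"
  shows "\<exists>F :: 'e \<Rightarrow>\<^sub>L real. norm F \<le> 1 \<and> (\<forall>s. blinfun_apply F s \<le> q s)"
proof -
  obtain p where p: "sublin p" "p \<le> q"
    and minimal: "\<And>r. sublin r \<Longrightarrow> r \<le> p \<Longrightarrow> r = p"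
    using minimal_sublin[OF assms] by blast
  have odd: "p (- s) = - p s" for s
  proof -
    obtain r where "sublin r" "r \<le> p" "r (- s) \<le> - p s" using sublin_shift[OF p(1)] by blast
    then have "p (- s) \<le> - p s" using minimal by blast
    then show ?thesis using sublinD(6)[OF p(1), of s] by simp
  qed
  have add: "p (s + s') = p s + p s'" for s s'
    using sublinD(1)[OF p(1), of s s'] sublinD(1)[OF p(1), of "- s" "- s'"]
      odd[of s] odd[of s'] odd[of "s + s'"] by simp
  have scale: "p (c *\<^sub>R s) = c * p s" for c s
  proof (cases "c \<ge> 0")
    case True
    then show ?thesis by (rule sublinD(7)[OF p(1)])
  next
    case False
    then have "p ((- c) *\<^sub>R s) = - c * p s" by (intro sublinD(7)[OF p(1)]) simp
    then show ?thesis using odd[of "c *\<^sub>R s"] by simp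
  qed
  have bound: "norm (p s) \<le> norm s * 1" for s
    using sublinD(3,5)[OF p(1), of s] by (simp add: abs_le_iff)
  have "bounded_linear p"
    by (rule bounded_linear_intro[where K = 1]) (use bound in \<open>auto simp: add scale\<close>)
  note apply_p = bounded_linear_Blinfun_apply[OF this]
  have "norm (Blinfun p) \<le> 1"
    by (rule norm_blinfun_bound) (use bound in \<open>simp_all add: apply_p\<close>)
  moreover have "blinfun_apply (Blinfun p) s \<le> q s" for s
    using p(2) by (simp add: apply_p le_fun_def)
  ultimately show ?thesis by blast
qed

text \<open>
  A linear form bounded by \<open>norm (A v) + r v\<close> splits into a part that factors through \<open>A\<close> and a
  remainder controlled by \<open>r\<close>. With \<open>r = 0\<close> and \<open>A\<close> a multiple of the identity this extends
  bounded functionals from \<open>M\<close>; a general \<open>A\<close> serves to express a functional on a tensor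
  product through finitely many functionals on one factor. The functional is found below
  the sublinear \<open>q\<close> of the proof: the index \<open>v = 0\<close> keeps \<open>q\<close> under the norm, and the index
  \<open>v\<close> bounds \<open>q (- A v)\<close> by \<open>r v - \<psi> v\<close>.
\<close>

lemma hahn_banach_with_error:
  fixes A :: "'v::real_vector \<Rightarrow> 'e::real_normed_vector" and \<psi> r :: "'v \<Rightarrow> real"
  assumes M: "subspace M" and A: "linear A" and \<psi>: "linear \<psi>"
    and r_add: "\<And>u v. r (u + v) \<le> r u + r v"
    and r_scale: "\<And>c v. c > 0 \<Longrightarrow> r (c *\<^sub>R v) = c * r v"
    and dominated: "\<And>v. v \<in> M \<Longrightarrow> \<psi> v \<le> norm (A v) + r v"
  shows "\<exists>F :: 'e \<Rightarrow>\<^sub>L real. norm F \<le> 1 \<and> (\<forall>v\<in>M. \<psi> v - blinfun_apply F (A v) \<le> r v)"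
proof -
  define q where "q s = (INF v\<in>M. norm (s + A v) + r v - \<psi> v)" for s
  have M0: "0 \<in> M" using M by (rule subspace_0)
  have r0: "r 0 = 0" using r_scale[of 2 0] by simp
  have lb: "- norm s \<le> norm (s + A v) + r v - \<psi> v" if "v \<in> M" for s v
    using dominated[OF that] norm_triangle_ineq4[of "s + A v" s] by simp
  have low: "q s \<le> norm (s + A v) + r v - \<psi> v" if "v \<in> M" for s v
    unfolding q_def using that lb by (intro cINF_lower) (auto intro!: bdd_belowI[of _ "- norm s"])
  have great: "m \<le> q s" if "\<And>v. v \<in> M \<Longrightarrow> m \<le> norm (s + A v) + r v - \<psi> v" for m s
    unfolding q_def using that M0 by (intro cINF_greatest) auto
  have "sublin q"
    unfolding sublin_def
  proof (intro conjI allI impI)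
    fix s s' :: 'e
    have two: "q (s + s') \<le> (norm (s + A v) + r v - \<psi> v) + (norm (s' + A v') + r v' - \<psi> v')"
      if "v \<in> M" "v' \<in> M" for v v'
    proof -
      have "q (s + s') \<le> norm ((s + s') + A (v + v')) + r (v + v') - \<psi> (v + v')"
        using that M by (intro low) (simp add: subspace_add)
      moreover have "norm ((s + s') + A (v + v')) \<le> norm (s + A v) + norm (s' + A v')"
        using norm_triangle_ineq[of "s + A v" "s' + A v'"]
        by (simp add: linear_add[OF A] algebra_simps)
      ultimately show ?thesis
        using r_add[of v v'] by (simp add: linear_add[OF \<psi>])
    qed
    have "q (s + s') - (norm (s' + A v') + r v' - \<psi> v') \<le> q s" if "v' \<in> M" for v'
    proof (rule great)
      fix v assume "v \<in> M"
      then show "q (s + s') - (norm (s' + A v') + r v' - \<psi> v') \<le> norm (s + A v) + r v - \<psi> v"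
        using two[of v v'] that by linarith
    qed
    then have "q (s + s') - q s \<le> q s'"
      by (intro great) (metis diff_le_eq add.commute)
    then show "q (s + s') \<le> q s + q s'" by simp
  next
    have le: "q (c *\<^sub>R s) \<le> c * q s" if c: "c > 0" for c s
    proof -
      have "q (c *\<^sub>R s) / c \<le> q s"
      proof (rule great)
        fix v assume v: "v \<in> M"
        have "q (c *\<^sub>R s) \<le> norm (c *\<^sub>R s + A (c *\<^sub>R v)) + r (c *\<^sub>R v) - \<psi> (c *\<^sub>R v)"
          using v M by (intro low) (simp add: subspace_scale)
        also have "c *\<^sub>R s + A (c *\<^sub>R v) = c *\<^sub>R (s + A v)"
          by (simp add: linear_cmul[OF A] algebra_simps)
        finally have "q (c *\<^sub>R s) \<le> c * norm (s + A v) + c * r v - c * \<psi> v"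
          using c by (simp add: linear_cmul[OF \<psi>] r_scale)
        also have "\<dots> = c * (norm (s + A v) + r v - \<psi> v)" by (simp add: algebra_simps)
        finally have "q (c *\<^sub>R s) \<le> c * (norm (s + A v) + r v - \<psi> v)" .
        then show "q (c *\<^sub>R s) / c \<le> norm (s + A v) + r v - \<psi> v"
          using c by (simp add: field_simps)
      qed
      then show ?thesis using c by (simp add: field_simps)
    qed
    fix c :: real and s :: 'e assume c: "c > 0"
    have "q ((1 / c) *\<^sub>R (c *\<^sub>R s)) \<le> (1 / c) * q (c *\<^sub>R s)" using c by (intro le) simp
    then have "c * q s \<le> q (c *\<^sub>R s)" using c by (simp add: field_simps)
    then show "q (c *\<^sub>R s) = c * q s" using le[OF c, of s] by simp
  next
    fix s show "q s \<le> norm s"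
      using low[OF M0, of s] by (simp add: r0 linear_0[OF A] linear_0[OF \<psi>])
  qed
  then obtain F :: "'e \<Rightarrow>\<^sub>L real" where F: "norm F \<le> 1" "\<And>s. blinfun_apply F s \<le> q s"
    using sublinear_dominates_functional by blast
  have "\<psi> v - blinfun_apply F (A v) \<le> r v" if "v \<in> M" for v
    using order_trans[OF F(2)[of "- A v"] low[OF that, of "- A v"]]
    by (simp add: blinfun.minus_right)
  then show ?thesis using F(1) by blast
qed

lemma norming_functional:
  fixes x :: "'a::real_normed_vector"
  shows "\<exists>f :: 'a \<Rightarrow>\<^sub>L real. norm f \<le> 1 \<and> blinfun_apply f x = norm x"
proof -
  have "\<exists>F :: 'a \<Rightarrow>\<^sub>L real. norm F \<le> 1 \<and> (\<forall>c\<in>UNIV. c * norm x - blinfun_apply F (c *\<^sub>R x) \<le> 0)"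
    by (rule hahn_banach_with_error)
      (auto simp: linear_iff algebra_simps intro!: mult_right_mono)
  then obtain F :: "'a \<Rightarrow>\<^sub>L real" where F: "norm F \<le> 1" "\<And>c. c * norm x - blinfun_apply F (c *\<^sub>R x) \<le> 0"
    by blast
  have "norm x \<le> blinfun_apply F x" using F(2)[of 1] by simp
  moreover have "blinfun_apply F x \<le> norm x"
    using F(2)[of "-1"] by (simp add: blinfun.minus_right)
  ultimately show ?thesis using F(1) by auto
qed

lemma norm_attained_on_dense:
  fixes F :: "'z::real_normed_vector \<Rightarrow>\<^sub>L real"
  assumes M: "subspace M" and dense: "closure M = UNIV" and c: "0 \<le> c" "c < norm F"
  shows "\<exists>u\<in>M. norm u = 1 \<and> c < blinfun_apply F u"
proof (rule ccontr)
  assume no: "\<not> ?thesis"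
  have le: "blinfun_apply F u \<le> c * norm u" if "u \<in> M" for u
  proof (cases "u = 0")
    case False
    then have "sgn u \<in> M" "norm (sgn u) = 1"
      using that M by (simp_all add: sgn_div_norm subspace_scale)
    then have "blinfun_apply F (sgn u) \<le> c" using no by force
    then show ?thesis
      using False by (simp add: sgn_div_norm blinfun.scaleR_right field_simps)
  qed simp
  have abs_le: "\<bar>F u\<bar> \<le> c * norm u" if "u \<in> M" for u
    using le[OF that] le[OF subspace_neg[OF M that]]
    by (simp add: blinfun.minus_right abs_le_iff)
  have "closed {u. \<bar>F u\<bar> \<le> c * norm u}"
    by (intro closed_Collect_le continuous_intros)
  then have "closure M \<subseteq> {u. \<bar>F u\<bar> \<le> c * norm u}"
    using abs_le by (intro closure_minimal) auto
  then have "\<bar>F u\<bar> \<le> c * norm u" for u using dense by auto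
  then have "norm F \<le> c" by (intro norm_blinfun_bound c(1)) simp
  then show False using c(2) by simp
qed

section \<open>The injective norm and elementary functionals\<close>

text \<open>
  The two factors play symmetric roles, so a result about operators on the dual of the first
  factor also applies to the second one.
\<close>

lemma tensor_swap:
  fixes t :: "'a::banach \<Rightarrow> 'b::banach \<Rightarrow> 'z::banach"
  assumes "injective_tensor_product t"
  shows "injective_tensor_product (\<lambda>y x. t x y)"
  unfolding injective_tensor_product_def
proof (intro conjI allI)
  have t: "tensor_map t" using assms by (simp add: injective_tensor_product_def)
  show "tensor_map (\<lambda>y x. t x y)"
    unfolding tensor_map_def
  proof (intro conjI allI impI)
    show "bilinear (\<lambda>y x. t x y)" using t by (simp add: tensor_map_def bilinear_def)
    fix B :: "'b \<Rightarrow> 'a \<Rightarrow> real" assume "bilinear B"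
    then have "bilinear (\<lambda>x y. B y x)" by (simp add: bilinear_def)
    then obtain L :: "'z \<Rightarrow> real" where "linear L" "\<forall>x y. L (t x y) = B y x"
      using t unfolding tensor_map_def by blast
    then show "\<exists>L. linear L \<and> (\<forall>y x. L (t x y) = B y x)" by blast
  qed
next
  fix n :: nat and y :: "nat \<Rightarrow> 'b" and x :: "nat \<Rightarrow> 'a"
  have "injective_norm n x y = injective_norm n y x"
    unfolding injective_norm_def
  proof (rule arg_cong[where f = Sup], rule set_eqI)
    fix r :: real
    show "r \<in> (\<lambda>(f, g). \<bar>\<Sum>i = 1..n. blinfun_apply f (x i) * blinfun_apply g (y i)\<bar>) ` (sphere 0 1 \<times> sphere 0 1)
      \<longleftrightarrow> r \<in> (\<lambda>(f, g). \<bar>\<Sum>i = 1..n. blinfun_apply f (y i) * blinfun_apply g (x i)\<bar>) ` (sphere 0 1 \<times> sphere 0 1)"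
      by (auto simp: image_iff mult.commute)
  qed
  then show "norm (\<Sum>i=1..n. t (x i) (y i)) = injective_norm n y x"
    using assms by (simp add: injective_tensor_product_def)
next
  have "{t x y | y x. True} = {t x y | x y. True}" by blast
  then show "closure (span {t x y | y x. True}) = UNIV"
    using assms by (simp add: injective_tensor_product_def)
qed

lemma tensor_norm_upper:
  fixes t :: "'a::banach \<Rightarrow> 'b::banach \<Rightarrow> 'z::banach"
  assumes nt: "nontrivial_space TYPE('a)" "nontrivial_space TYPE('b)"
    and t: "injective_tensor_product t"
    and bound: "\<And>(f :: 'a \<Rightarrow>\<^sub>L real) (g :: 'b \<Rightarrow>\<^sub>L real). norm f = 1 \<Longrightarrow> norm g = 1 \<Longrightarrow>
      \<bar>\<Sum>i=1..n. blinfun_apply f (x i) * blinfun_apply g (y i)\<bar> \<le> C"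
  shows "norm (\<Sum>i=1..n::nat. t (x i) (y i)) \<le> C"
proof -
  obtain f0 :: "'a \<Rightarrow>\<^sub>L real" and g0 :: "'b \<Rightarrow>\<^sub>L real" where "norm f0 = 1" "norm g0 = 1"
    using nontrivial_dual_sphere[OF nt(1)] nontrivial_dual_sphere[OF nt(2)] by blast
  then have "(f0, g0) \<in> sphere 0 1 \<times> sphere 0 1" by simp
  then have "injective_norm n x y \<le> C"
    unfolding injective_norm_def using bound by (intro cSUP_least) auto
  then show ?thesis using t by (simp add: injective_tensor_product_def)
qed

lemma tensor_norm_lower:
  fixes t :: "'a::banach \<Rightarrow> 'b::banach \<Rightarrow> 'z::banach"
  assumes t: "injective_tensor_product t"
  shows "\<bar>\<Sum>i=1..n::nat. blinfun_apply f (x i) * blinfun_apply g (y i)\<bar>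
    \<le> norm f * norm g * norm (\<Sum>i=1..n. t (x i) (y i))"
proof (cases "f = 0 \<or> g = 0")
  case True
  then show ?thesis by auto
next
  case False
  let ?S = "\<lambda>(f :: 'a \<Rightarrow>\<^sub>L real) (g :: 'b \<Rightarrow>\<^sub>L real). \<bar>\<Sum>i=1..n. blinfun_apply f (x i) * blinfun_apply g (y i)\<bar>"
  have "bdd_above ((\<lambda>p. ?S (fst p) (snd p)) ` (sphere 0 1 \<times> sphere 0 1))"
  proof (rule bdd_aboveI2)
    fix p :: "('a \<Rightarrow>\<^sub>L real) \<times> ('b \<Rightarrow>\<^sub>L real)" assume p: "p \<in> sphere 0 1 \<times> sphere 0 1"
    show "?S (fst p) (snd p) \<le> (\<Sum>i=1..n. norm (x i) * norm (y i))"
    proof (rule order_trans[OF sum_abs], rule sum_mono)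
      fix i
      show "\<bar>blinfun_apply (fst p) (x i) * blinfun_apply (snd p) (y i)\<bar> \<le> norm (x i) * norm (y i)"
        using p norm_blinfun[of "fst p" "x i"] norm_blinfun[of "snd p" "y i"]
        by (auto simp: abs_mult mem_Times_iff intro!: mult_mono)
    qed
  qed
  then have "?S (sgn f) (sgn g) \<le> injective_norm n x y"
    unfolding injective_norm_def
    using cSUP_upper[of "(sgn f, sgn g)" "sphere 0 1 \<times> sphere 0 1" "\<lambda>p. ?S (fst p) (snd p)"] False
    by (simp add: norm_sgn case_prod_beta)
  also have "injective_norm n x y = norm (\<Sum>i=1..n. t (x i) (y i))"
    using t by (simp add: injective_tensor_product_def)
  also have "?S (sgn f) (sgn g) = ?S f g / (norm f * norm g)"
  proof -
    have "(\<Sum>i=1..n. blinfun_apply (sgn f) (x i) * blinfun_apply (sgn g) (y i))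
        = (\<Sum>i=1..n. blinfun_apply f (x i) * blinfun_apply g (y i)) / (norm f * norm g)"
      by (simp add: sgn_div_norm blinfun.scaleR_left sum_divide_distrib field_simps)
    then show ?thesis by (simp add: abs_mult)
  qed
  finally show ?thesis using False by (simp add: field_simps)
qed

lemma bounded_bilinear_tensor:
  fixes t :: "'a::banach \<Rightarrow> 'b::banach \<Rightarrow> 'z::banach"
  assumes nt: "nontrivial_space TYPE('a)" "nontrivial_space TYPE('b)"
    and t: "injective_tensor_product t"
  shows "bounded_bilinear t"
proof -
  have bil: "bilinear t" using t by (simp add: injective_tensor_product_def tensor_map_def)
  have "norm (t x y) \<le> norm x * norm y * 1" for x y
  proof -
    have "norm (\<Sum>i=1..1::nat. t x y) \<le> norm x * norm y"
    proof (rule tensor_norm_upper[OF nt t])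
      fix f :: "'a \<Rightarrow>\<^sub>L real" and g :: "'b \<Rightarrow>\<^sub>L real" assume "norm f = 1" "norm g = 1"
      then show "\<bar>\<Sum>i=1..1::nat. blinfun_apply f x * blinfun_apply g y\<bar> \<le> norm x * norm y"
        using norm_blinfun[of f x] norm_blinfun[of g y] by (auto simp: abs_mult intro!: mult_mono)
    qed
    then show ?thesis by simp
  qed
  then show ?thesis
    by (intro bounded_bilinear.intro exI[of _ 1])
      (simp_all add: bilinear_ladd[OF bil] bilinear_radd[OF bil] bilinear_lmul[OF bil]
        bilinear_rmul[OF bil])
qed

lemma span_tensors_sum:
  assumes bil: "bilinear t" and z: "z \<in> span {t x y | x y. True}"
  shows "\<exists>n x y. z = (\<Sum>i=1..n::nat. t (x i) (y i))"
  using z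
proof (induction rule: span_induct_alt)
  case base
  show ?case by (intro exI[of _ 0]) simp
next
  case (step c u z)
  from step(2) obtain n :: nat and x y where z: "z = (\<Sum>i=1..n. t (x i) (y i))" by (elim exE)
  from step(1) obtain x' y' where u: "u = t x' y'" by blast
  define x2 where "x2 = x(Suc n := c *\<^sub>R x')"
  define y2 where "y2 = y(Suc n := y')"
  have "(\<Sum>i=1..Suc n. t (x2 i) (y2 i)) = (\<Sum>i=1..n. t (x2 i) (y2 i)) + t (c *\<^sub>R x') y'"
    by (simp add: x2_def y2_def)
  also have "(\<Sum>i=1..n. t (x2 i) (y2 i)) = (\<Sum>i=1..n. t (x i) (y i))"
    by (rule sum.cong) (auto simp: x2_def y2_def)
  finally show ?case by (metis z u bilinear_lmul[OF bil] add.commute)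
qed

text \<open>
  The functional \<open>f \<otimes> g\<close> on the completed tensor product. Its values on the tensors \<open>t x y\<close>
  determine it by density, so the choice is immaterial.
\<close>

definition elementary_functional ::
    "('a::banach \<Rightarrow> 'b::banach \<Rightarrow> 'z::banach) \<Rightarrow> ('a \<Rightarrow>\<^sub>L real) \<Rightarrow> ('b \<Rightarrow>\<^sub>L real) \<Rightarrow> 'z \<Rightarrow>\<^sub>L real" where
  "elementary_functional t f g = (SOME F. norm F \<le> norm f * norm g \<and>
    (\<forall>x y. blinfun_apply F (t x y) = blinfun_apply f x * blinfun_apply g y))"

text \<open>
  The universal property of the algebraic tensor product gives a linear form with the right
  values, but without control outside the span of the tensors. There the injective norm
  bounds it, and Hahn-Banach extends it again, now as a bounded functional.
\<close>

lemma elementary_functional_exists: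
  fixes t :: "'a::banach \<Rightarrow> 'b::banach \<Rightarrow> 'z::banach"
  assumes t: "injective_tensor_product t"
  shows "\<exists>F :: 'z \<Rightarrow>\<^sub>L real. norm F \<le> norm f * norm g \<and>
    (\<forall>x y. blinfun_apply F (t x y) = blinfun_apply f x * blinfun_apply g y)"
proof -
  have tm: "tensor_map t" using t by (simp add: injective_tensor_product_def)
  then have bil: "bilinear t" by (simp add: tensor_map_def)
  have "bilinear (\<lambda>x y. blinfun_apply f x * blinfun_apply g y)"
    by (simp add: bilinear_def linear_iff blinfun.add_right blinfun.scaleR_right algebra_simps)
  then obtain L :: "'z \<Rightarrow> real" where L: "linear L"
    and Lt: "\<And>x y. L (t x y) = blinfun_apply f x * blinfun_apply g y"
    using tm unfolding tensor_map_def by blast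
  let ?M = "span {t x y | x y. True}"
  let ?c = "norm f * norm g"
  have "\<exists>F :: 'z \<Rightarrow>\<^sub>L real. norm F \<le> 1 \<and> (\<forall>z\<in>?M. L z - blinfun_apply F (?c *\<^sub>R z) \<le> 0)"
  proof (rule hahn_banach_with_error[OF _ _ L])
    fix z assume "z \<in> ?M"
    then obtain n x y where z: "z = (\<Sum>i=1..n::nat. t (x i) (y i))"
      using span_tensors_sum[OF bil] by blast
    show "L z \<le> norm (?c *\<^sub>R z) + 0"
      using tensor_norm_lower[OF t, of f x g y n] by (simp add: z linear_sum[OF L] Lt)
  qed (auto simp: linear_iff algebra_simps)
  then obtain F :: "'z \<Rightarrow>\<^sub>L real" where F: "norm F \<le> 1"
    and le: "\<And>z. z \<in> ?M \<Longrightarrow> L z - blinfun_apply F (?c *\<^sub>R z) \<le> 0" by blast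
  have "blinfun_apply (?c *\<^sub>R F) (t x y) = L (t x y)" for x y
  proof -
    have "t x y \<in> ?M" by (auto intro: span_base)
    then show ?thesis
      using le[of "t x y"] le[of "- t x y"]
      by (simp add: span_neg linear_neg[OF L] blinfun.minus_right blinfun.scaleR_right
          blinfun.scaleR_left)
  qed
  moreover have "norm (?c *\<^sub>R F) \<le> ?c" using F by (simp add: mult_left_le)
  ultimately show ?thesis by (metis Lt)
qed

lemma elementary_functional:
  assumes "injective_tensor_product t"
  shows norm_elementary_functional: "norm (elementary_functional t f g) \<le> norm f * norm g"
    and elementary_functional_tensor:
      "blinfun_apply (elementary_functional t f g) (t x y) = blinfun_apply f x * blinfun_apply g y"
  using someI_ex[OF elementary_functional_exists[OF assms, of f g]]
  by (simp_all add: elementary_functional_def)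

lemma elementary_functional_swap:
  "elementary_functional (\<lambda>y x. t x y) g f = elementary_functional t f g"
proof -
  have "(norm F \<le> norm g * norm f \<and>
      (\<forall>y x. blinfun_apply F (t x y) = blinfun_apply g y * blinfun_apply f x)) \<longleftrightarrow>
    (norm F \<le> norm f * norm g \<and>
      (\<forall>x y. blinfun_apply F (t x y) = blinfun_apply f x * blinfun_apply g y))" for F
    by (subst all_comm) (simp add: mult.commute)
  then show ?thesis by (simp add: elementary_functional_def)
qed

lemma elementary_functional_sum:
  assumes "injective_tensor_product t"
  shows "blinfun_apply (elementary_functional t f g) (\<Sum>i=1..n::nat. t (x i) (y i))
    = (\<Sum>i=1..n. blinfun_apply f (x i) * blinfun_apply g (y i))"
  by (simp add: blinfun.sum_right elementary_functional_tensor[OF assms])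

lemma elementary_functional_norming:
  fixes t :: "'a::banach \<Rightarrow> 'b::banach \<Rightarrow> 'z::banach"
  assumes nt: "nontrivial_space TYPE('a)" "nontrivial_space TYPE('b)"
    and t: "injective_tensor_product t"
    and z: "z \<in> span {t x y | x y. True}" and c: "c < norm z"
  shows "\<exists>f g. norm f = 1 \<and> norm g = 1 \<and> c < blinfun_apply (elementary_functional t f g) z"
proof (rule ccontr)
  assume no: "\<not> ?thesis"
  have bil: "bilinear t" using t by (simp add: injective_tensor_product_def tensor_map_def)
  obtain n x y where z: "z = (\<Sum>i=1..n::nat. t (x i) (y i))"
    using span_tensors_sum[OF bil z] by blast
  have le: "(\<Sum>i=1..n. blinfun_apply f (x i) * blinfun_apply g (y i)) \<le> c"
    if "norm f = 1" "norm g = 1" for f g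
  proof -
    have "\<not> c < blinfun_apply (elementary_functional t f g) z" using no that by blast
    then show ?thesis by (simp only: z elementary_functional_sum[OF t] not_less)
  qed
  have "norm z \<le> c"
    unfolding z
  proof (rule tensor_norm_upper[OF nt t])
    fix f :: "'a \<Rightarrow>\<^sub>L real" and g :: "'b \<Rightarrow>\<^sub>L real" assume fg: "norm f = 1" "norm g = 1"
    show "\<bar>\<Sum>i=1..n. blinfun_apply f (x i) * blinfun_apply g (y i)\<bar> \<le> c"
      using le[OF fg] le[of "- f" g] fg
      by (simp add: abs_le_iff blinfun.minus_left sum_negf)
  qed
  then show False using c by simp
qed

section \<open>Integral forms are almost finite sums on finitely many vectors\<close>

definition coordinate_embedding :: "nat \<Rightarrow> 'a::real_normed_vector \<Rightarrow>\<^sub>L (nat \<Rightarrow>\<^sub>C 'a)" where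
  "coordinate_embedding k = Blinfun (\<lambda>x. Bcontfun (\<lambda>i. if i = k then x else 0))"

lemma coordinate_embedding_nth:
  "apply_bcontfun (blinfun_apply (coordinate_embedding k) x) i = (if i = k then x else 0)"
proof -
  have mem: "(\<lambda>i. if i = k then x else 0) \<in> bcontfun" for x :: 'a
    by (rule bcontfun_normI[where b = "norm x"]) auto
  note nth = Bcontfun_inverse[OF mem]
  have "bounded_linear (\<lambda>x::'a. Bcontfun (\<lambda>i. if i = k then x else 0))"
  proof (rule bounded_linear_intro[where K = 1])
    show "norm (Bcontfun (\<lambda>i. if i = k then x else 0)) \<le> norm x * 1" for x :: 'a
      by (rule norm_bound) (simp add: nth)
  qed (rule bcontfun_eqI, simp add: nth)+
  then show ?thesis by (simp add: coordinate_embedding_def bounded_linear_Blinfun_apply nth)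
qed

lemma sum_coordinate_embedding_nth:
  "apply_bcontfun (\<Sum>k<m. blinfun_apply (coordinate_embedding k) (s k)) i = (if i < m then s i else 0)"
  by (induction m) (auto simp: coordinate_embedding_nth less_Suc_eq)

lemma norm_sum_coordinate_embedding_le:
  assumes "0 \<le> B" "\<And>k. k < m \<Longrightarrow> norm (s k) \<le> B"
  shows "norm (\<Sum>k<m. blinfun_apply (coordinate_embedding k) (s k)) \<le> B"
  using assms by (intro norm_bound) (simp add: sum_coordinate_embedding_nth)

lemma norm_le_sum_coordinate_embedding:
  assumes "k < m"
  shows "norm (s k) \<le> norm (\<Sum>k<m. blinfun_apply (coordinate_embedding k) (s k))"
  using norm_bounded[of "\<Sum>k<m. blinfun_apply (coordinate_embedding k) (s k)" k] assms
  by (simp add: sum_coordinate_embedding_nth)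

lemma almost_norming_vector:
  fixes f :: "'a::real_normed_vector \<Rightarrow>\<^sub>L real"
  assumes "e > 0"
  shows "\<exists>x. norm x \<le> 1 \<and> norm f - e \<le> blinfun_apply f x"
proof (cases "0 < norm f - e")
  case True
  have "\<exists>u\<in>UNIV. norm u = 1 \<and> norm f - e < blinfun_apply f u"
    by (rule norm_attained_on_dense) (use assms True in auto)
  then obtain u where "norm u = 1" "norm f - e < blinfun_apply f u" by blast
  then show ?thesis by (intro exI[of _ u]) simp
next
  case False
  then show ?thesis by (intro exI[of _ 0]) simp
qed

text \<open>
  The dual of \<open>\<ell>\<^sup>\<infinity>\<close> restricts to \<open>\<ell>\<^sup>1\<close> on finitely supported sequences: inserting a vector
  that nearly norms each coordinate keeps the sequence in the unit ball.
\<close>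

lemma sum_norm_coordinates_le:
  fixes F :: "(nat \<Rightarrow>\<^sub>C 'a::real_normed_vector) \<Rightarrow>\<^sub>L real"
  shows "(\<Sum>k<m. norm (F o\<^sub>L coordinate_embedding k)) \<le> norm F"
proof (rule field_le_epsilon)
  fix e :: real assume e: "e > 0"
  define d where "d = e / (real m + 1)"
  have d: "d > 0" "real m * d \<le> e" using e by (auto simp: d_def field_simps)
  have "\<forall>k. \<exists>x. norm x \<le> 1 \<and>
      norm (F o\<^sub>L coordinate_embedding k) - d \<le> blinfun_apply (F o\<^sub>L coordinate_embedding k) x"
    using almost_norming_vector[OF d(1)] by blast
  from choice[OF this] obtain s where s: "\<And>k. norm (s k) \<le> 1"
    "\<And>k. norm (F o\<^sub>L coordinate_embedding k) - d \<le> blinfun_apply (F o\<^sub>L coordinate_embedding k) (s k)"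
    by blast
  have "(\<Sum>k<m. norm (F o\<^sub>L coordinate_embedding k) - d)
      \<le> (\<Sum>k<m. blinfun_apply (F o\<^sub>L coordinate_embedding k) (s k))"
    by (intro sum_mono s(2))
  also have "\<dots> = blinfun_apply F (\<Sum>k<m. blinfun_apply (coordinate_embedding k) (s k))"
    by (simp add: blinfun.sum_right)
  also have "\<dots> \<le> norm F * norm (\<Sum>k<m. blinfun_apply (coordinate_embedding k) (s k))"
    using norm_blinfun[of F "\<Sum>k<m. blinfun_apply (coordinate_embedding k) (s k)"]
    unfolding real_norm_def by (rule abs_le_D1)
  also have "\<dots> \<le> norm F * 1"
    using s(1) by (intro mult_left_mono norm_sum_coordinate_embedding_le) auto
  finally show "(\<Sum>k<m. norm (F o\<^sub>L coordinate_embedding k)) \<le> norm F + e"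
    using d(2) by (simp add: sum_subtractf)
qed

text \<open>
  On finitely many vectors the unit ball of the dual is totally bounded. Two functionals
  whose values on all \<open>b j\<close> lie in the same cells of a grid of mesh \<open>\<delta>\<close> are \<open>\<delta>\<close>-close there,
  and only finitely many cells are met.
\<close>

lemma finite_net_of_functionals:
  fixes b :: "nat \<Rightarrow> 'b::real_normed_vector"
  assumes \<delta>: "\<delta> > 0"
  shows "\<exists>G :: ('b \<Rightarrow>\<^sub>L real) set. finite G \<and> G \<subseteq> cball 0 1 \<and>
    (\<forall>g. norm g \<le> 1 \<longrightarrow> (\<exists>g'\<in>G. \<forall>j\<in>{1..n}. \<bar>blinfun_apply g (b j) - blinfun_apply g' (b j)\<bar> \<le> \<delta>))"
proof -
  define h :: "('b \<Rightarrow>\<^sub>L real) \<Rightarrow> nat \<Rightarrow> int"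
    where "h g = (\<lambda>j\<in>{1..n}. \<lfloor>blinfun_apply g (b j) / \<delta>\<rfloor>)" for g
  define K where "K j = \<lceil>norm (b j) / \<delta>\<rceil> + 1" for j
  have "h ` cball 0 1 \<subseteq> PiE {1..n} (\<lambda>j. {- K j..K j})"
  proof (rule image_subsetI)
    fix g :: "'b \<Rightarrow>\<^sub>L real" assume g: "g \<in> cball 0 1"
    show "h g \<in> PiE {1..n} (\<lambda>j. {- K j..K j})"
      unfolding h_def
    proof (rule restrict_PiE_iff[THEN iffD2], rule ballI)
      fix j assume "j \<in> {1..n}"
      have "\<bar>blinfun_apply g (b j)\<bar> \<le> norm (b j)"
        using g norm_blinfun[of g "b j"] mult_right_mono[of "norm g" 1 "norm (b j)"] by simp
      then have "\<bar>blinfun_apply g (b j) / \<delta>\<bar> \<le> norm (b j) / \<delta>"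
        using \<delta> by (simp add: divide_right_mono)
      then show "\<lfloor>blinfun_apply g (b j) / \<delta>\<rfloor> \<in> {- K j..K j}"
        unfolding K_def atLeastAtMost_iff by linarith
    qed
  qed
  then have "finite (h ` cball 0 1)"
    by (rule finite_subset) (simp add: finite_PiE)
  then obtain G where G: "G \<subseteq> cball 0 1" "finite G" "h ` cball 0 1 = h ` G"
    using finite_subset_image[of "h ` cball 0 1" h "cball 0 1"] by auto
  have "\<exists>g'\<in>G. \<forall>j\<in>{1..n}. \<bar>blinfun_apply g (b j) - blinfun_apply g' (b j)\<bar> \<le> \<delta>"
    if "norm g \<le> 1" for g
  proof -
    have "h g \<in> h ` G" using that G(3) by (metis image_eqI mem_cball_0)
    then obtain g' where g': "g' \<in> G" "h g = h g'" by blast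
    have "\<bar>blinfun_apply g (b j) - blinfun_apply g' (b j)\<bar> \<le> \<delta>" if "j \<in> {1..n}" for j
    proof -
      have "\<lfloor>blinfun_apply g (b j) / \<delta>\<rfloor> = \<lfloor>blinfun_apply g' (b j) / \<delta>\<rfloor>"
        using fun_cong[OF g'(2), of j] that by (simp add: h_def)
      then have "\<bar>blinfun_apply g (b j) / \<delta> - blinfun_apply g' (b j) / \<delta>\<bar> \<le> 1" by linarith
      then show ?thesis
        using \<delta> by (simp flip: diff_divide_distrib)
    qed
    then show ?thesis using g'(1) by blast
  qed
  then show ?thesis using G(1,2) by blast
qed

definition left_slot :: "('a::banach \<Rightarrow> 'b::banach \<Rightarrow> 'z::banach) \<Rightarrow> 'b \<Rightarrow> 'a \<Rightarrow>\<^sub>L 'z" where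
  "left_slot t y = Blinfun (\<lambda>x. t x y)"

lemma left_slot_apply:
  assumes "bounded_bilinear t"
  shows "blinfun_apply (left_slot t y) x = t x y"
  using bounded_bilinear.bounded_linear_left[OF assms]
  by (simp add: left_slot_def bounded_linear_Blinfun_apply)

text \<open>
  Up to the mesh error, the injective norm is a maximum of finitely many norms in the first
  factor, those of the contractions of the tensor by the functionals in the net.
\<close>

lemma tensor_norm_upper_net:
  fixes t :: "'a::banach \<Rightarrow> 'b::banach \<Rightarrow> 'z::banach"
  assumes nt: "nontrivial_space TYPE('a)" "nontrivial_space TYPE('b)"
    and t: "injective_tensor_product t"
    and net: "\<And>g :: 'b \<Rightarrow>\<^sub>L real. norm g \<le> 1 \<Longrightarrow>
      \<exists>g'\<in>G. \<forall>j\<in>{1..n}. \<bar>blinfun_apply g (y j) - blinfun_apply g' (y j)\<bar> \<le> \<delta>"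
    and bound: "\<And>g. g \<in> G \<Longrightarrow> norm (\<Sum>j=1..n. blinfun_apply g (y j) *\<^sub>R x j) \<le> C"
  shows "norm (\<Sum>j=1..n::nat. t (x j) (y j)) \<le> C + \<delta> * (\<Sum>j=1..n. norm (x j))"
proof (rule tensor_norm_upper[OF nt t])
  fix f :: "'a \<Rightarrow>\<^sub>L real" and g :: "'b \<Rightarrow>\<^sub>L real" assume f: "norm f = 1" and g: "norm g = 1"
  obtain g' where g': "g' \<in> G"
    and close: "\<forall>j\<in>{1..n}. \<bar>blinfun_apply g (y j) - blinfun_apply g' (y j)\<bar> \<le> \<delta>"
    using net[of g] g by auto
  let ?v = "\<Sum>j=1..n. blinfun_apply g' (y j) *\<^sub>R x j"
  have fx: "\<bar>blinfun_apply f v\<bar> \<le> norm v" for v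
    using norm_blinfun[of f v] f by simp
  have "(\<Sum>j=1..n. blinfun_apply f (x j) * blinfun_apply g (y j))
      = blinfun_apply f ?v
        + (\<Sum>j=1..n. (blinfun_apply g (y j) - blinfun_apply g' (y j)) * blinfun_apply f (x j))"
    by (simp add: blinfun.sum_right blinfun.scaleR_right algebra_simps flip: sum.distrib)
  moreover have "\<bar>blinfun_apply f ?v\<bar> \<le> C"
    using fx[of ?v] bound[OF g'] by linarith
  moreover have "\<bar>\<Sum>j=1..n. (blinfun_apply g (y j) - blinfun_apply g' (y j)) * blinfun_apply f (x j)\<bar>
      \<le> (\<Sum>j=1..n. \<delta> * norm (x j))"
  proof (rule order_trans[OF sum_abs], rule sum_mono)
    fix j assume "j \<in> {1..n}"
    with close have "\<bar>blinfun_apply g (y j) - blinfun_apply g' (y j)\<bar> \<le> \<delta>" by blast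
    then show "\<bar>(blinfun_apply g (y j) - blinfun_apply g' (y j)) * blinfun_apply f (x j)\<bar>
        \<le> \<delta> * norm (x j)"
      using fx[of "x j"] by (simp add: abs_mult mult_mono')
  qed
  ultimately show "\<bar>\<Sum>j=1..n. blinfun_apply f (x j) * blinfun_apply g (y j)\<bar>
      \<le> C + \<delta> * (\<Sum>j=1..n. norm (x j))"
    by (simp add: sum_distrib_left)
qed

text \<open>
  The maximum of the contractions of a tensor by a finite net is its norm as a sequence in
  \<open>\<ell>\<^sup>\<infinity>\<close> over the first factor, so \<open>hahn_banach_with_error\<close> expresses \<open>\<Psi>\<close> through a functional
  on that space, up to a small error. Its coordinates, which are absolutely summable with sum
  at most its norm, are the \<open>f k\<close>. Thus on the tensors \<open>x \<otimes> b j\<close> the functional \<open>\<Psi>\<close> is nearly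
  the element \<open>\<Sum> f k \<otimes> g k\<close> of the projective tensor product of the duals, with no loss of
  norm. Bounded sequences also represent the tuples \<open>(x 1, \<dots>, x n)\<close>: only the entries with
  index in \<open>{1..n}\<close> count.
\<close>

lemma finite_projective_approximation:
  fixes t :: "'a::banach \<Rightarrow> 'b::banach \<Rightarrow> 'z::banach" and \<Psi> :: "'z \<Rightarrow>\<^sub>L real"
    and b :: "nat \<Rightarrow> 'b"
  assumes nt: "nontrivial_space TYPE('a)" "nontrivial_space TYPE('b)"
    and t: "injective_tensor_product t" and \<delta>: "\<delta> > 0"
  shows "\<exists>(m::nat) (f :: nat \<Rightarrow> 'a \<Rightarrow>\<^sub>L real) (g :: nat \<Rightarrow> 'b \<Rightarrow>\<^sub>L real).
    (\<forall>k<m. norm (g k) \<le> 1) \<and> (\<Sum>k<m. norm (f k)) \<le> norm \<Psi> \<and>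
    (\<forall>j\<in>{1..n}. norm ((\<Psi> o\<^sub>L left_slot t (b j)) - (\<Sum>k<m. blinfun_apply (g k) (b j) *\<^sub>R f k)) \<le> \<delta>)"
proof -
  note bb = bounded_bilinear_tensor[OF nt t]
  have lin1: "linear (\<lambda>x. t x y)" for y
    using bounded_bilinear.bounded_linear_left[OF bb] by (rule bounded_linear.linear)
  define c where "c = norm \<Psi>"
  define \<delta>' where "\<delta>' = \<delta> / (c + 1)"
  have c: "c \<ge> 0" by (simp add: c_def)
  then have \<delta>': "\<delta>' > 0" "c * \<delta>' \<le> \<delta>" using \<delta> by (auto simp: \<delta>'_def field_simps)
  obtain G :: "('b \<Rightarrow>\<^sub>L real) set" where G: "finite G" "G \<subseteq> cball 0 1"
    and net: "\<And>g. norm g \<le> 1 \<Longrightarrow>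
      \<exists>g'\<in>G. \<forall>j\<in>{1..n}. \<bar>blinfun_apply g (b j) - blinfun_apply g' (b j)\<bar> \<le> \<delta>'"
    using finite_net_of_functionals[OF \<delta>'(1), of n b] by blast
  define m where "m = card G"
  obtain g where g: "bij_betw g {0..<m} G"
    using ex_bij_betw_nat_finite[OF G(1)] by (auto simp: m_def)
  have gk: "norm (g k) \<le> 1" if "k < m" for k
  proof -
    have "g k \<in> G" using bij_betwE[OF g] that by simp
    then have "g k \<in> cball 0 1" using G(2) by blast
    then show ?thesis by simp
  qed
  define A where "A a = (\<Sum>k<m. blinfun_apply (coordinate_embedding k)
      (c *\<^sub>R (\<Sum>j=1..n. blinfun_apply (g k) (b j) *\<^sub>R apply_bcontfun a j)))" for a :: "nat \<Rightarrow>\<^sub>C 'a"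
  define \<psi> where "\<psi> a = blinfun_apply \<Psi> (\<Sum>j=1..n. t (apply_bcontfun a j) (b j))" for a :: "nat \<Rightarrow>\<^sub>C 'a"
  define r where "r a = c * \<delta>' * (\<Sum>j=1..n. norm (apply_bcontfun a j))" for a :: "nat \<Rightarrow>\<^sub>C 'a"
  have "\<exists>F. norm F \<le> 1 \<and> (\<forall>a\<in>UNIV. \<psi> a - blinfun_apply F (A a) \<le> r a)"
  proof (rule hahn_banach_with_error)
    show "linear A"
    proof (rule linearI)
      show "A (a + a') = A a + A a'" for a a'
        by (simp add: A_def blinfun.add_right scaleR_add_right sum.distrib)
      have homogeneous: "(\<Sum>j=1..n. blinfun_apply (g k) (b j) *\<^sub>R apply_bcontfun (d *\<^sub>R a) j)
          = d *\<^sub>R (\<Sum>j=1..n. blinfun_apply (g k) (b j) *\<^sub>R apply_bcontfun a j)" for d a k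
        by (simp add: scaleR_sum_right mult.commute)
      show "A (d *\<^sub>R a) = d *\<^sub>R A a" for d a
        by (simp only: A_def homogeneous blinfun.scaleR_right scaleR_sum_right[symmetric]
            scaleR_left_commute[of c d])
    qed
    show "linear \<psi>"
      unfolding \<psi>_def
      by (intro linearI)
        (simp_all add: linear_add[OF lin1] linear_cmul[OF lin1] sum.distrib blinfun.add_right
          blinfun.scaleR_right flip: scaleR_sum_right)
    show "r (a + a') \<le> r a + r a'" for a a'
    proof -
      have "(\<Sum>j=1..n. norm (apply_bcontfun (a + a') j))
          \<le> (\<Sum>j=1..n. norm (apply_bcontfun a j) + norm (apply_bcontfun a' j))"
        by (intro sum_mono) (simp add: norm_triangle_ineq)
      then have "r (a + a') \<le> c * \<delta>' * (\<Sum>j=1..n. norm (apply_bcontfun a j) + norm (apply_bcontfun a' j))"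
        unfolding r_def using c \<delta>'(1) by (intro mult_left_mono) auto
      then show ?thesis by (simp add: r_def sum.distrib algebra_simps)
    qed
    show "r (d *\<^sub>R a) = d * r a" if "d > 0" for d a
      using that by (simp add: r_def flip: sum_distrib_left)
    fix a :: "nat \<Rightarrow>\<^sub>C 'a"
    define A' where "A' = (\<Sum>k<m. blinfun_apply (coordinate_embedding k)
      (\<Sum>j=1..n. blinfun_apply (g k) (b j) *\<^sub>R apply_bcontfun a j))"
    have A': "A a = c *\<^sub>R A'"
      by (simp add: A_def A'_def blinfun.scaleR_right scaleR_sum_right[symmetric])
    have "norm (\<Sum>j=1..n. t (apply_bcontfun a j) (b j))
        \<le> norm A' + \<delta>' * (\<Sum>j=1..n. norm (apply_bcontfun a j))"
    proof (rule tensor_norm_upper_net[OF nt t net])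
      fix h assume "h \<in> G"
      then obtain k where k: "k < m" "h = g k" using g unfolding bij_betw_def by auto
      show "norm (\<Sum>j=1..n. blinfun_apply h (b j) *\<^sub>R apply_bcontfun a j) \<le> norm A'"
        unfolding k(2) A'_def using k(1)
        by (rule norm_le_sum_coordinate_embedding[where s = "\<lambda>k. \<Sum>j=1..n. blinfun_apply (g k) (b j) *\<^sub>R apply_bcontfun a j"])
    qed
    then have "c * norm (\<Sum>j=1..n. t (apply_bcontfun a j) (b j))
        \<le> c * (norm A' + \<delta>' * (\<Sum>j=1..n. norm (apply_bcontfun a j)))"
      using c by (rule mult_left_mono)
    also have "\<dots> = norm (A a) + r a" using c by (simp add: A' r_def distrib_left mult.assoc)
    finally have "c * norm (\<Sum>j=1..n. t (apply_bcontfun a j) (b j)) \<le> norm (A a) + r a" .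
    moreover have "\<psi> a \<le> c * norm (\<Sum>j=1..n. t (apply_bcontfun a j) (b j))"
      using norm_blinfun[of \<Psi> "\<Sum>j=1..n. t (apply_bcontfun a j) (b j)"]
      unfolding \<psi>_def c_def real_norm_def by (rule abs_le_D1)
    ultimately show "\<psi> a \<le> norm (A a) + r a" by linarith
  qed simp
  then obtain F where F: "norm F \<le> 1" and le: "\<And>a. \<psi> a - blinfun_apply F (A a) \<le> r a" by blast
  define f where "f k = c *\<^sub>R (F o\<^sub>L coordinate_embedding k)" for k
  have "(\<Sum>k<m. norm (f k)) = c * (\<Sum>k<m. norm (F o\<^sub>L coordinate_embedding k))"
    using c by (simp add: f_def sum_distrib_left)
  also have "\<dots> \<le> c * 1"
    using c F sum_norm_coordinates_le[where m = m and F = F] by (intro mult_left_mono) linarith+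
  finally have sum_f: "(\<Sum>k<m. norm (f k)) \<le> norm \<Psi>" by (simp add: c_def)
  have "norm ((\<Psi> o\<^sub>L left_slot t (b j)) - (\<Sum>k<m. blinfun_apply (g k) (b j) *\<^sub>R f k)) \<le> \<delta>"
    if j: "j \<in> {1..n}" for j
  proof (rule norm_blinfun_bound)
    fix x :: 'a
    \<comment> \<open>Test the splitting on the tuple with \<open>x\<close> in place \<open>j\<close> and zeros elsewhere.\<close>
    have one: "blinfun_apply \<Psi> (t x (b j)) - (\<Sum>k<m. blinfun_apply (g k) (b j) * blinfun_apply (f k) x)
        \<le> \<delta> * norm x" for x
    proof -
      let ?a = "blinfun_apply (coordinate_embedding j) x"
      have "\<psi> ?a = (\<Sum>i=1..n. if i = j then blinfun_apply \<Psi> (t x (b j)) else 0)"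
        unfolding \<psi>_def blinfun.sum_right
        by (intro sum.cong) (auto simp: coordinate_embedding_nth linear_0[OF lin1])
      then have 1: "\<psi> ?a = blinfun_apply \<Psi> (t x (b j))" using j by simp
      have "r ?a = c * \<delta>' * (\<Sum>i=1..n. if i = j then norm x else 0)"
        unfolding r_def
        by (intro arg_cong2[where f = "(*)"] sum.cong) (auto simp: coordinate_embedding_nth)
      then have "r ?a = c * \<delta>' * norm x" using j by simp
      then have 2: "r ?a \<le> \<delta> * norm x" using \<delta>'(2) by (simp add: mult_right_mono)
      have "(\<Sum>i=1..n. blinfun_apply (g k) (b i) *\<^sub>R apply_bcontfun ?a i)
          = blinfun_apply (g k) (b j) *\<^sub>R x" for k
      proof -
        have "(\<Sum>i=1..n. blinfun_apply (g k) (b i) *\<^sub>R apply_bcontfun ?a i)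
            = (\<Sum>i=1..n. if i = j then blinfun_apply (g k) (b j) *\<^sub>R x else 0)"
          by (intro sum.cong) (auto simp: coordinate_embedding_nth)
        then show ?thesis using j by simp
      qed
      then have 3: "blinfun_apply F (A ?a) = (\<Sum>k<m. blinfun_apply (g k) (b j) * blinfun_apply (f k) x)"
        by (simp add: A_def f_def blinfun.sum_right blinfun.scaleR_right blinfun.scaleR_left mult_ac)
      show ?thesis using le[of ?a] 1 2 3 by linarith
    qed
    have eq: "blinfun_apply ((\<Psi> o\<^sub>L left_slot t (b j)) - (\<Sum>k<m. blinfun_apply (g k) (b j) *\<^sub>R f k)) x
        = blinfun_apply \<Psi> (t x (b j)) - (\<Sum>k<m. blinfun_apply (g k) (b j) * blinfun_apply (f k) x)"
      by (simp add: blinfun.diff_left blinfun.sum_left blinfun.scaleR_left left_slot_apply[OF bb])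
    show "norm (blinfun_apply ((\<Psi> o\<^sub>L left_slot t (b j)) - (\<Sum>k<m. blinfun_apply (g k) (b j) *\<^sub>R f k)) x)
        \<le> \<delta> * norm x"
      unfolding eq using one[of x] one[of "- x"]
      by (simp add: abs_le_iff linear_neg[OF lin1] blinfun.minus_right sum_negf)
  qed (use \<delta> in simp)
  then show ?thesis using gk sum_f by blast
qed

section \<open>Operators on the dual of the first factor\<close>

lemma norm_contracted_tensor_le:
  fixes t :: "'a::banach \<Rightarrow> 'b::banach \<Rightarrow> 'z::banach"
  assumes t: "injective_tensor_product t" and g: "norm g \<le> 1"
  shows "norm (\<Sum>j=1..n. blinfun_apply g (y j) *\<^sub>R x j) \<le> norm (\<Sum>j=1..n::nat. t (x j) (y j))"
proof -
  let ?v = "\<Sum>j=1..n. blinfun_apply g (y j) *\<^sub>R x j"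
  obtain f :: "'a \<Rightarrow>\<^sub>L real" where f: "norm f \<le> 1" "blinfun_apply f ?v = norm ?v"
    using norming_functional[of ?v] by blast
  have "norm ?v = (\<Sum>j=1..n. blinfun_apply f (x j) * blinfun_apply g (y j))"
    unfolding f(2)[symmetric] by (simp add: blinfun.sum_right blinfun.scaleR_right mult.commute)
  also have "\<dots> \<le> norm f * norm g * norm (\<Sum>j=1..n. t (x j) (y j))"
    using tensor_norm_lower[OF t, of f x g y n] by (rule abs_le_D1)
  also have "\<dots> \<le> 1 * 1 * norm (\<Sum>j=1..n. t (x j) (y j))"
    using f(1) g by (intro mult_right_mono mult_mono) auto
  finally show ?thesis by simp
qed

text \<open>
  This is the ideal property of integral operators: read \<open>\<Psi>\<close> as the operator sending \<open>y\<close> to the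
  functional \<open>x \<mapsto> \<Psi> (t x y)\<close>; composing it with \<open>T\<close> multiplies its norm as a functional on the
  tensor product by at most \<open>norm T\<close>. As \<open>T\<close> need not be an adjoint, its action cannot be moved
  to the vectors \<open>a j\<close>. But for a finite sum \<open>\<Sum> f k \<otimes> g k\<close> the bound with
  \<open>\<Sum> norm (f k) * norm (g k)\<close> in place of \<open>norm \<Psi>\<close> is immediate, and \<open>\<Psi>\<close> is nearly such a sum on the given vectors.
\<close>

lemma operator_on_dual_bound:
  fixes t :: "'a::banach \<Rightarrow> 'b::banach \<Rightarrow> 'z::banach" and \<Psi> :: "'z \<Rightarrow>\<^sub>L real"
    and T :: "('a \<Rightarrow>\<^sub>L real) \<Rightarrow>\<^sub>L ('a \<Rightarrow>\<^sub>L real)"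
  assumes nt: "nontrivial_space TYPE('a)" "nontrivial_space TYPE('b)"
    and t: "injective_tensor_product t"
  shows "(\<Sum>j=1..n::nat. blinfun_apply (blinfun_apply T (\<Psi> o\<^sub>L left_slot t (b j))) (a j))
    \<le> norm T * norm \<Psi> * norm (\<Sum>j=1..n. t (a j) (b j))"
proof (rule field_le_epsilon)
  fix e :: real assume e: "e > 0"
  let ?u = "\<Sum>j=1..n. t (a j) (b j)"
  define C where "C = norm T * (\<Sum>j=1..n. norm (a j))"
  have C: "C \<ge> 0" by (simp add: C_def sum_nonneg)
  define \<delta> where "\<delta> = e / (C + 1)"
  have \<delta>: "\<delta> > 0" "\<delta> * C \<le> e" using e C by (auto simp: \<delta>_def field_simps)
  obtain m :: nat and f g where g: "\<And>k. k < m \<Longrightarrow> norm (g k) \<le> 1"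
    and f: "(\<Sum>k<m. norm (f k)) \<le> norm \<Psi>"
    and close: "\<And>j. j \<in> {1..n} \<Longrightarrow>
      norm ((\<Psi> o\<^sub>L left_slot t (b j)) - (\<Sum>k<m. blinfun_apply (g k) (b j) *\<^sub>R f k)) \<le> \<delta>"
    using finite_projective_approximation[OF nt t \<delta>(1), of \<Psi> n b] by blast
  define D where "D j = (\<Psi> o\<^sub>L left_slot t (b j)) - (\<Sum>k<m. blinfun_apply (g k) (b j) *\<^sub>R f k)" for j
  have "(\<Sum>j=1..n. blinfun_apply (blinfun_apply T (\<Psi> o\<^sub>L left_slot t (b j))) (a j))
      = (\<Sum>j=1..n. (\<Sum>k<m. blinfun_apply (g k) (b j) * blinfun_apply (blinfun_apply T (f k)) (a j))
          + blinfun_apply (blinfun_apply T (D j)) (a j))"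
  proof (rule sum.cong[OF refl])
    fix j
    have "\<Psi> o\<^sub>L left_slot t (b j) = (\<Sum>k<m. blinfun_apply (g k) (b j) *\<^sub>R f k) + D j"
      by (simp add: D_def)
    then show "blinfun_apply (blinfun_apply T (\<Psi> o\<^sub>L left_slot t (b j))) (a j)
      = (\<Sum>k<m. blinfun_apply (g k) (b j) * blinfun_apply (blinfun_apply T (f k)) (a j))
          + blinfun_apply (blinfun_apply T (D j)) (a j)"
      by (simp add: blinfun.add_right blinfun.add_left blinfun.sum_right blinfun.sum_left
          blinfun.scaleR_right blinfun.scaleR_left)
  qed
  also have "\<dots> = (\<Sum>j=1..n. \<Sum>k<m. blinfun_apply (g k) (b j) * blinfun_apply (blinfun_apply T (f k)) (a j))
      + (\<Sum>j=1..n. blinfun_apply (blinfun_apply T (D j)) (a j))"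
    by (rule sum.distrib)
  also have "(\<Sum>j=1..n. \<Sum>k<m. blinfun_apply (g k) (b j) * blinfun_apply (blinfun_apply T (f k)) (a j))
      = (\<Sum>k<m. blinfun_apply (blinfun_apply T (f k)) (\<Sum>j=1..n. blinfun_apply (g k) (b j) *\<^sub>R a j))"
    by (subst sum.swap) (simp add: blinfun.sum_right blinfun.scaleR_right)
  also have "\<dots> \<le> (\<Sum>k<m. norm T * norm (f k) * norm ?u)"
  proof (rule sum_mono)
    fix k assume "k \<in> {..<m}"
    then have "norm (\<Sum>j=1..n. blinfun_apply (g k) (b j) *\<^sub>R a j) \<le> norm ?u"
      using norm_contracted_tensor_le[OF t g] by simp
    moreover have "norm (blinfun_apply T (f k)) \<le> norm T * norm (f k)" by (rule norm_blinfun)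
    ultimately have "norm (blinfun_apply T (f k)) * norm (\<Sum>j=1..n. blinfun_apply (g k) (b j) *\<^sub>R a j)
        \<le> norm T * norm (f k) * norm ?u"
      by (intro mult_mono) auto
    then show "blinfun_apply (blinfun_apply T (f k)) (\<Sum>j=1..n. blinfun_apply (g k) (b j) *\<^sub>R a j)
        \<le> norm T * norm (f k) * norm ?u"
      using norm_blinfun[of "blinfun_apply T (f k)" "\<Sum>j=1..n. blinfun_apply (g k) (b j) *\<^sub>R a j"]
      unfolding real_norm_def by linarith
  qed
  also have "\<dots> = norm T * (\<Sum>k<m. norm (f k)) * norm ?u"
    by (simp add: sum_distrib_left sum_distrib_right)
  also have "\<dots> \<le> norm T * norm \<Psi> * norm ?u"
    using f by (intro mult_right_mono mult_left_mono) auto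
  also have "(\<Sum>j=1..n. blinfun_apply (blinfun_apply T (D j)) (a j)) \<le> (\<Sum>j=1..n. norm T * \<delta> * norm (a j))"
  proof (rule sum_mono)
    fix j assume "j \<in> {1..n}"
    then have "norm (D j) \<le> \<delta>" using close by (simp add: D_def)
    then have "norm (blinfun_apply T (D j)) \<le> norm T * \<delta>"
      using norm_blinfun[of T "D j"] mult_left_mono[of "norm (D j)" \<delta> "norm T"] by simp
    then have "norm (blinfun_apply T (D j)) * norm (a j) \<le> norm T * \<delta> * norm (a j)"
      by (rule mult_right_mono) simp
    then show "blinfun_apply (blinfun_apply T (D j)) (a j) \<le> norm T * \<delta> * norm (a j)"
      using norm_blinfun[of "blinfun_apply T (D j)" "a j"] unfolding real_norm_def by linarith
  qed
  also have "\<dots> = \<delta> * C" by (simp add: C_def sum_distrib_left mult_ac)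
  also have "\<dots> \<le> e" by (rule \<delta>(2))
  finally show "(\<Sum>j=1..n. blinfun_apply (blinfun_apply T (\<Psi> o\<^sub>L left_slot t (b j))) (a j))
      \<le> norm T * norm \<Psi> * norm ?u + e" by simp
qed

text \<open>
  The weak operator Daugavet property of a dual, in the form used below: the slice is the one
  cut out by evaluation at a vector, and the almost fixed functionals are not normalised, so
  that zero is allowed among them.
\<close>

lemma wodp_dual_weak_star_slice:
  fixes h :: "nat \<Rightarrow> 'a::banach \<Rightarrow>\<^sub>L real" and x0 :: 'a
  assumes nt: "nontrivial_space TYPE('a)"
    and wodp: "weak_operator_daugavet_property TYPE('a \<Rightarrow>\<^sub>L real)"
    and f0: "norm f0 \<le> 1" "c < blinfun_apply f0 x0" and f1: "norm f1 \<le> 1" and \<delta>: "\<delta> > 0"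
  shows "\<exists>f (T :: ('a \<Rightarrow>\<^sub>L real) \<Rightarrow>\<^sub>L ('a \<Rightarrow>\<^sub>L real)). norm f \<le> 1 \<and> c < blinfun_apply f x0 \<and>
    norm T \<le> 1 + \<delta> \<and> (\<forall>j\<in>{1..n}. norm (blinfun_apply T (h j) - h j) \<le> \<delta> * norm (h j)) \<and>
    norm (blinfun_apply T f - f1) < \<delta>"
proof -
  define ev :: "('a \<Rightarrow>\<^sub>L real) \<Rightarrow>\<^sub>L real" where "ev = Blinfun (\<lambda>f. blinfun_apply f x0)"
  have ev: "blinfun_apply ev f = blinfun_apply f x0" for f
    by (simp add: ev_def bounded_linear_Blinfun_apply[OF blinfun.bounded_linear_left])
  define s where "s = (SUP f\<in>cball 0 1. blinfun_apply ev f)"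
  have "bdd_above (blinfun_apply ev ` cball 0 1)"
  proof (rule bdd_aboveI2)
    fix f :: "'a \<Rightarrow>\<^sub>L real" assume "f \<in> cball 0 1"
    then have "norm ev * norm f \<le> norm ev" by (simp add: mult_left_le)
    then show "blinfun_apply ev f \<le> norm ev"
      using norm_blinfun[of ev f] unfolding real_norm_def by linarith
  qed
  then have "blinfun_apply ev f0 \<le> s"
    unfolding s_def using f0(1) by (intro cSUP_upper) auto
  then have s: "c < s" using f0(2) by (simp add: ev)
  have slice: "ball_slice ev (s - c) = {f. norm f \<le> 1 \<and> c < blinfun_apply f x0}"
    by (auto simp: ball_slice_def ev[abs_def] s_def[unfolded ev[abs_def]])
  obtain e :: "'a \<Rightarrow>\<^sub>L real" where e: "norm e = 1" using nontrivial_dual_sphere[OF nt] by blast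
  \<comment> \<open>Where \<open>h j\<close> vanishes, any unit functional keeps the tuple on the sphere.\<close>
  define u where "u j = (if h j = 0 then e else sgn (h j))" for j
  have "\<forall>j\<in>{1..n}. u j \<in> sphere 0 1" using e by (simp add: u_def norm_sgn)
  moreover have "f1 \<in> cball 0 1" "s - c > 0" using f1 s by auto
  ultimately obtain f and T :: "('a \<Rightarrow>\<^sub>L real) \<Rightarrow>\<^sub>L ('a \<Rightarrow>\<^sub>L real)"
    where f: "f \<in> ball_slice ev (s - c)" and T: "norm T \<le> 1 + \<delta>"
      "\<forall>j\<in>{1..n}. norm (blinfun_apply T (u j) - u j) < \<delta>" "norm (blinfun_apply T f - f1) < \<delta>"
    using wodp[unfolded weak_operator_daugavet_property_def, rule_format, of n u \<delta> "s - c" f1 ev] \<delta>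
    by blast
  have "norm (blinfun_apply T (h j) - h j) \<le> \<delta> * norm (h j)" if "j \<in> {1..n}" for j
  proof (cases "h j = 0")
    case False
    then have hj: "h j = norm (h j) *\<^sub>R u j" by (simp add: u_def sgn_div_norm)
    have "blinfun_apply T (h j) - h j = norm (h j) *\<^sub>R (blinfun_apply T (u j) - u j)"
      by (subst (1 2) hj) (simp add: blinfun.scaleR_right scaleR_diff_right)
    then have "norm (blinfun_apply T (h j) - h j) = norm (h j) * norm (blinfun_apply T (u j) - u j)"
      by simp
    also have "\<dots> \<le> norm (h j) * \<delta>"
      using T(2) that by (intro mult_left_mono) (auto intro: less_imp_le)
    finally show ?thesis by (simp add: mult.commute)
  qed simp
  then show ?thesis using f T(1,3) unfolding slice by blast
qed

section \<open>Moving an elementary functional into a slice\<close>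

text \<open>
  Let \<open>u = \<Sum> t (a j) (b j)\<close> nearly norm \<open>\<Psi> + f1 \<otimes> g1\<close>. Choose \<open>f\<close> in the slice and \<open>T\<close> such
  that \<open>T\<close> almost fixes the finitely many functionals \<open>x \<mapsto> \<Psi> (t x (b j))\<close> and sends \<open>f\<close> close to
  \<open>f1\<close>. Then \<open>T\<close> turns \<open>\<Psi> + f \<otimes> g1\<close> into a form whose value at \<open>u\<close> is close to that of
  \<open>\<Psi> + f1 \<otimes> g1\<close>, and \<open>operator_on_dual_bound\<close> says that this value is at most about
  \<open>norm (\<Psi> + f \<otimes> g1)\<close>. Only the finitely many functionals attached to \<open>u\<close> must be almost
  fixed, so a general \<open>\<Psi>\<close> is treated like a finite sum of elementary functionals.
\<close>

lemma slice_replacement: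
  fixes t :: "'a::banach \<Rightarrow> 'b::banach \<Rightarrow> 'z::banach" and \<Psi> :: "'z \<Rightarrow>\<^sub>L real"
  assumes nt: "nontrivial_space TYPE('a)" "nontrivial_space TYPE('b)"
    and wodp: "weak_operator_daugavet_property TYPE('a \<Rightarrow>\<^sub>L real)"
    and t: "injective_tensor_product t"
    and f0: "norm f0 \<le> 1" "c < blinfun_apply f0 x0"
    and f1: "norm f1 \<le> 1" and g1: "norm g1 \<le> 1"
    and N: "N < norm (\<Psi> + elementary_functional t f1 g1)"
  shows "\<exists>f. norm f \<le> 1 \<and> c < blinfun_apply f x0 \<and>
    N < norm (\<Psi> + elementary_functional t f g1)"
proof (cases "N < 0")
  case True
  then show ?thesis using f0 norm_ge_zero order_less_le_trans by blast
next
  case False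
  note bb = bounded_bilinear_tensor[OF nt t]
  have bil: "bilinear t" using t by (simp add: injective_tensor_product_def tensor_map_def)
  let ?\<Phi> = "\<lambda>f. \<Psi> + elementary_functional t f g1"
  have dense: "closure (span {t x y | x y. True}) = UNIV"
    using t by (simp add: injective_tensor_product_def)
  obtain u where u: "u \<in> span {t x y | x y. True}" "norm u = 1" "N < blinfun_apply (?\<Phi> f1) u"
    using norm_attained_on_dense[OF subspace_span dense _ N] False by auto
  obtain n :: nat and a b where u_sum: "u = (\<Sum>j=1..n. t (a j) (b j))"
    using span_tensors_sum[OF bil u(1)] by (elim exE)
  define h where "h j = \<Psi> o\<^sub>L left_slot t (b j)" for j
  define C where "C = (\<Sum>j=1..n. (norm (h j) + norm (b j)) * norm (a j))"
  have C: "C \<ge> 0" by (simp add: C_def sum_nonneg)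
  define d where "d = blinfun_apply (?\<Phi> f1) u - N"
  have d: "d > 0" using u(3) by (simp add: d_def)
  \<comment> \<open>The error of the exchange is \<open>\<delta> * C\<close> from the functionals that \<open>T\<close> moves, plus
    \<open>\<delta> * norm (\<Psi> + f \<otimes> g1) \<le> \<delta> * (norm \<Psi> + 1)\<close> from \<open>norm T \<le> 1 + \<delta>\<close>; it stays strictly below \<open>d\<close>.\<close>
  define \<delta> where "\<delta> = d / (C + norm \<Psi> + 2)"
  have pos: "C + norm \<Psi> + 2 > 0" using C by (simp add: add_nonneg_pos)
  then have \<delta>: "\<delta> > 0" "\<delta> * (C + norm \<Psi> + 2) = d" using d by (simp_all add: \<delta>_def)
  obtain f and T :: "('a \<Rightarrow>\<^sub>L real) \<Rightarrow>\<^sub>L ('a \<Rightarrow>\<^sub>L real)"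
    where f: "norm f \<le> 1" "c < blinfun_apply f x0" and T: "norm T \<le> 1 + \<delta>"
      and Th: "\<And>j. j \<in> {1..n} \<Longrightarrow> norm (blinfun_apply T (h j) - h j) \<le> \<delta> * norm (h j)"
      and Tf: "norm (blinfun_apply T f - f1) < \<delta>"
    using wodp_dual_weak_star_slice[OF nt(1) wodp f0 f1 \<delta>(1), of n h] by blast
  have slot: "?\<Phi> f' o\<^sub>L left_slot t (b j) = h j + blinfun_apply g1 (b j) *\<^sub>R f'" for f' j
    by (rule blinfun_eqI)
      (simp add: h_def blinfun.add_left blinfun.scaleR_left left_slot_apply[OF bb]
        elementary_functional_tensor[OF t])
  have g1b: "\<bar>blinfun_apply g1 (b j)\<bar> \<le> norm (b j)" for j
    using norm_blinfun[of g1 "b j"] mult_right_mono[OF g1, of "norm (b j)"] by simp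
  have "blinfun_apply (?\<Phi> f1) u
      = (\<Sum>j=1..n. blinfun_apply (?\<Phi> f1 o\<^sub>L left_slot t (b j)) (a j))"
    unfolding u_sum blinfun.sum_right by (simp add: left_slot_apply[OF bb])
  also have "\<dots> \<le> (\<Sum>j=1..n. blinfun_apply (blinfun_apply T (?\<Phi> f o\<^sub>L left_slot t (b j))) (a j)
      + \<delta> * ((norm (h j) + norm (b j)) * norm (a j)))"
  proof (rule sum_mono)
    fix j assume j: "j \<in> {1..n}"
    define E where "E = (?\<Phi> f1 o\<^sub>L left_slot t (b j)) - blinfun_apply T (?\<Phi> f o\<^sub>L left_slot t (b j))"
    have "E = - ((blinfun_apply T (h j) - h j) + blinfun_apply g1 (b j) *\<^sub>R (blinfun_apply T f - f1))"
      by (simp add: E_def slot blinfun.add_right blinfun.scaleR_right scaleR_diff_right)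
    then have "norm E \<le> norm (blinfun_apply T (h j) - h j)
        + \<bar>blinfun_apply g1 (b j)\<bar> * norm (blinfun_apply T f - f1)"
      by (metis norm_minus_cancel norm_scaleR norm_triangle_ineq)
    also have "\<dots> \<le> \<delta> * norm (h j) + norm (b j) * \<delta>"
      using Th[OF j] Tf g1b[of j] by (intro add_mono mult_mono) auto
    finally have "norm E * norm (a j) \<le> (\<delta> * norm (h j) + norm (b j) * \<delta>) * norm (a j)"
      by (rule mult_right_mono) simp
    then have "blinfun_apply E (a j) \<le> (\<delta> * norm (h j) + norm (b j) * \<delta>) * norm (a j)"
      using norm_blinfun[of E "a j"] unfolding real_norm_def by linarith
    then show "blinfun_apply (?\<Phi> f1 o\<^sub>L left_slot t (b j)) (a j)
        \<le> blinfun_apply (blinfun_apply T (?\<Phi> f o\<^sub>L left_slot t (b j))) (a j)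
          + \<delta> * ((norm (h j) + norm (b j)) * norm (a j))"
      unfolding E_def blinfun.diff_left by (simp add: algebra_simps)
  qed
  also have "\<dots> = (\<Sum>j=1..n. blinfun_apply (blinfun_apply T (?\<Phi> f o\<^sub>L left_slot t (b j))) (a j)) + \<delta> * C"
    by (simp only: sum.distrib C_def sum_distrib_left)
  also have "\<dots> \<le> norm T * norm (?\<Phi> f) * norm u + \<delta> * C"
    unfolding u_sum using operator_on_dual_bound[OF nt t, of T "?\<Phi> f" b a n] by (rule add_right_mono)
  also have "\<dots> \<le> (1 + \<delta>) * norm (?\<Phi> f) * norm u + \<delta> * C"
    using T by (intro add_right_mono mult_right_mono) auto
  finally have le: "blinfun_apply (?\<Phi> f1) u \<le> norm (?\<Phi> f) + \<delta> * norm (?\<Phi> f) + \<delta> * C"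
    by (simp add: u(2) algebra_simps)
  have "norm (elementary_functional t f g1) \<le> 1"
    using norm_elementary_functional[OF t, of f g1] mult_mono[OF f(1) g1] by simp
  then have "norm (?\<Phi> f) \<le> norm \<Psi> + 1"
    using norm_triangle_ineq[of \<Psi> "elementary_functional t f g1"] by linarith
  then have "\<delta> * norm (?\<Phi> f) \<le> \<delta> * (norm \<Psi> + 1)" using \<delta>(1) by (intro mult_left_mono) auto
  with le have "blinfun_apply (?\<Phi> f1) u \<le> norm (?\<Phi> f) + \<delta> * (C + norm \<Psi> + 1)"
    by (simp add: algebra_simps)
  also have "\<dots> < norm (?\<Phi> f) + d" using \<delta> by (simp add: algebra_simps)
  finally have "N < norm (?\<Phi> f)" by (simp add: d_def)
  then show ?thesis using f by blast
qed

text \<open>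
  For a fixed \<open>g\<close>, the slice condition on \<open>f \<otimes> g\<close> is a weak* slice condition on \<open>f\<close>, as
  \<open>slice_replacement\<close> demands.
\<close>

lemma elementary_slice_contraction:
  fixes t :: "'a::banach \<Rightarrow> 'b::banach \<Rightarrow> 'z::banach"
  assumes t: "injective_tensor_product t" and z: "z \<in> span {t x y | x y. True}"
  shows "\<exists>x0. \<forall>f. blinfun_apply (elementary_functional t f g) z = blinfun_apply f x0"
proof -
  have bil: "bilinear t" using t by (simp add: injective_tensor_product_def tensor_map_def)
  obtain n :: nat and x y where z: "z = (\<Sum>i=1..n. t (x i) (y i))"
    using span_tensors_sum[OF bil z] by (elim exE)
  show ?thesis
    by (intro exI[of _ "\<Sum>i=1..n. blinfun_apply g (y i) *\<^sub>R x i"] allI)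
      (simp add: z elementary_functional_tensor[OF t] blinfun.sum_right blinfun.scaleR_right mult.commute)
qed

text \<open>
  Of two elementary functionals, \<open>f1 \<otimes> g1\<close> nearly norms a vector \<open>u\<close> at which \<open>\<phi>\<close> almost attains
  its norm, so that \<open>\<phi> + f1 \<otimes> g1\<close> has almost the norm \<open>norm \<phi> + 1\<close>, and \<open>f0 \<otimes> g0\<close> lies in the
  slice given by \<open>z\<close>. The first is moved into the slice one factor at a time:
  \<open>f1\<close> is replaced by some \<open>f\<close> with \<open>f \<otimes> g0\<close> in the slice, then \<open>g1\<close> by some \<open>g\<close> with \<open>f \<otimes> g\<close> in
  the slice.
\<close>

lemma elementary_functional_daugavet:
  fixes t :: "'a::banach \<Rightarrow> 'b::banach \<Rightarrow> 'z::banach" and \<phi> :: "'z \<Rightarrow>\<^sub>L real"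
  assumes nt: "nontrivial_space TYPE('a)" "nontrivial_space TYPE('b)"
    and wodp_a: "weak_operator_daugavet_property TYPE('a \<Rightarrow>\<^sub>L real)"
    and wodp_b: "weak_operator_daugavet_property TYPE('b \<Rightarrow>\<^sub>L real)"
    and t: "injective_tensor_product t"
    and \<phi>: "\<phi> \<noteq> 0" and z: "norm z = 1" and e: "e > 0"
  shows "\<exists>f g. norm f \<le> 1 \<and> norm g \<le> 1 \<and> 1 - e < blinfun_apply (elementary_functional t f g) z \<and>
    norm \<phi> + 1 - e < norm (\<phi> + elementary_functional t f g)"
proof -
  let ?M = "span {t x y | x y. True}"
  have dense: "closure ?M = UNIV" using t by (simp add: injective_tensor_product_def)
  have t': "injective_tensor_product (\<lambda>y x. t x y)" by (rule tensor_swap[OF t])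
  have M': "{t x y | y x. True} = {t x y | x y. True}" by blast
  have "0 \<le> max 0 (norm \<phi> - e / 2)" "max 0 (norm \<phi> - e / 2) < norm \<phi>" using \<phi> e by auto
  from norm_attained_on_dense[OF subspace_span dense this]
  obtain u where u: "u \<in> ?M" "norm u = 1" "norm \<phi> - e / 2 < blinfun_apply \<phi> u" by auto
  have "1 - e / 2 < norm u" using u(2) e by simp
  from elementary_functional_norming[OF nt t u(1) this]
  obtain f1 g1 where f1: "norm f1 = 1" and g1: "norm g1 = 1"
    and u1: "1 - e / 2 < blinfun_apply (elementary_functional t f1 g1) u" by blast
  have "norm \<phi> + 1 - e < blinfun_apply (\<phi> + elementary_functional t f1 g1) u"
    using u(3) u1 by (simp add: blinfun.add_left)
  also have "\<dots> \<le> norm (\<phi> + elementary_functional t f1 g1)"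
    using norm_blinfun[of "\<phi> + elementary_functional t f1 g1" u] u(2) by simp
  finally have N1: "norm \<phi> + 1 - e < norm (\<phi> + elementary_functional t f1 g1)" .
  \<comment> \<open>Slices are computed at a finite sum \<open>w\<close> of tensors near \<open>z\<close>.\<close>
  have "z \<in> closure ?M" using dense by simp
  then obtain w where w: "w \<in> ?M" "dist w z < e / 4"
    unfolding closure_approachable using e by (meson divide_pos_pos zero_less_numeral)
  have wz: "norm (w - z) < e / 4" using w(2) by (simp add: dist_norm)
  have "1 - e / 2 < norm w"
    using norm_triangle_ineq2[of z w] wz z e by (simp add: norm_minus_commute)
  from elementary_functional_norming[OF nt t w(1) this]
  obtain f0 g0 where f0: "norm f0 = 1" and g0: "norm g0 = 1"
    and w0: "1 - e / 2 < blinfun_apply (elementary_functional t f0 g0) w" by blast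
  obtain x0 where x0: "\<And>f. blinfun_apply (elementary_functional t f g0) w = blinfun_apply f x0"
    using elementary_slice_contraction[OF t w(1), of g0] by blast
  obtain f where f: "norm f \<le> 1" "1 - e / 2 < blinfun_apply (elementary_functional t f g0) w"
    and N2: "norm \<phi> + 1 - e < norm (\<phi> + elementary_functional t f g1)"
    using slice_replacement[OF nt wodp_a t _ w0[unfolded x0] _ _ N1] f0 f1 g1
    unfolding x0 by auto
  obtain y0 where y0: "\<And>g. blinfun_apply (elementary_functional t f g) w = blinfun_apply g y0"
    using elementary_slice_contraction[OF t', of w f] w(1)
    unfolding elementary_functional_swap[of t] M' by blast
  note g0_slice = f(2)[unfolded y0]
  obtain g where g: "norm g \<le> 1" "1 - e / 2 < blinfun_apply (elementary_functional t f g) w"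
    and N3: "norm \<phi> + 1 - e < norm (\<phi> + elementary_functional t f g)"
    using slice_replacement[OF nt(2,1) wodp_b t' _ g0_slice, of g1 f "norm \<phi> + 1 - e" \<phi>]
      g0 g1 f(1) N2
    unfolding elementary_functional_swap[of t] y0 by auto
  have "norm (elementary_functional t f g) \<le> 1"
    using norm_elementary_functional[OF t, of f g] mult_mono[OF f(1) g(1)] by simp
  then have "\<bar>blinfun_apply (elementary_functional t f g) (w - z)\<bar> \<le> norm (w - z)"
    using norm_blinfun[of "elementary_functional t f g" "w - z"]
      mult_right_mono[of "norm (elementary_functional t f g)" 1 "norm (w - z)"] by simp
  then have "1 - e < blinfun_apply (elementary_functional t f g) z"
    using g(2) wz e by (simp add: blinfun.diff_right)
  then show ?thesis using f(1) g(1) N3 by blast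
qed

section \<open>The Daugavet equation\<close>

lemma rank_one_form:
  fixes G :: "'z::banach \<Rightarrow>\<^sub>L 'z"
  assumes "dim (range (blinfun_apply G)) = 1"
  shows "\<exists>(\<phi> :: 'z \<Rightarrow>\<^sub>L real) z. norm z = 1 \<and> (\<forall>w. blinfun_apply G w = blinfun_apply \<phi> w *\<^sub>R z)"
proof -
  obtain B where B: "range (blinfun_apply G) \<subseteq> span B" "card B = 1"
    "independent B"
    using assms basis_exists[of "range (blinfun_apply G)"] by metis
  then obtain v where v: "B = {v}" using card_1_singletonE by blast
  have "v \<noteq> 0" using B(3) v dependent_zero by blast
  define z where "z = sgn v"
  have z: "norm z = 1" using \<open>v \<noteq> 0\<close> by (simp add: z_def norm_sgn)
  obtain h :: "'z \<Rightarrow>\<^sub>L real" where h: "blinfun_apply h z = 1"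
    using norming_functional[of z] z by auto
  have "blinfun_apply G w = blinfun_apply (h o\<^sub>L G) w *\<^sub>R z" for w
  proof -
    have "blinfun_apply G w \<in> span {v}" using B(1) v by blast
    then obtain k where k: "blinfun_apply G w = k *\<^sub>R v" by (auto simp: span_singleton)
    have "v = norm v *\<^sub>R z" using \<open>v \<noteq> 0\<close> by (simp add: z_def sgn_div_norm)
    then have "blinfun_apply G w = (k * norm v) *\<^sub>R z" using k by (metis scaleR_scaleR)
    then show ?thesis by (simp add: blinfun.scaleR_right h)
  qed
  then show ?thesis using z by blast
qed

theorem theorem3p5:
  fixes t :: "'a::banach \<Rightarrow> 'b::banach \<Rightarrow> 'z::banach"
  assumes "nontrivial_space TYPE('a)"
    and "nontrivial_space TYPE('b)"
    and "weak_operator_daugavet_property TYPE('a \<Rightarrow>\<^sub>L real)"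
    and "weak_operator_daugavet_property TYPE('b \<Rightarrow>\<^sub>L real)"
    and "injective_tensor_product t"
  shows "daugavet_property TYPE('z)"
  unfolding daugavet_property_def
proof (intro allI impI antisym)
  fix G :: "'z \<Rightarrow>\<^sub>L 'z" assume "dim (range (blinfun_apply G)) = 1"
  then obtain \<phi> :: "'z \<Rightarrow>\<^sub>L real" and z where z: "norm z = 1"
    and G: "\<And>w. blinfun_apply G w = blinfun_apply \<phi> w *\<^sub>R z"
    using rank_one_form by blast
  show "norm (G + id_blinfun) \<le> 1 + norm G"
    using norm_triangle_ineq[of G id_blinfun] norm_blinfun_id_le[where 'a = 'z] by linarith
  have "norm G \<le> norm \<phi>"
    by (rule norm_blinfun_bound) (use norm_blinfun[of \<phi>] in \<open>auto simp: G z\<close>)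
  moreover have "norm \<phi> + 1 \<le> norm (G + id_blinfun)"
  proof (cases "\<phi> = 0")
    case True
    then have "blinfun_apply (G + id_blinfun) z = z" by (simp add: blinfun.add_left G)
    then show ?thesis using True norm_blinfun[of "G + id_blinfun" z] z by simp
  next
    case False
    show ?thesis
    proof (rule field_le_epsilon)
      fix e :: real assume e: "e > 0"
      define d where "d = e / (1 + norm \<phi>)"
      have "0 < 1 + norm \<phi>" by (simp add: add_pos_nonneg)
      then have d: "d > 0" "d * (1 + norm \<phi>) = e" using e by (simp_all add: d_def)
      obtain f g where f: "norm f \<le> 1" and g: "norm g \<le> 1"
        and slice: "1 - d < blinfun_apply (elementary_functional t f g) z"
        and large: "norm \<phi> + 1 - d < norm (\<phi> + elementary_functional t f g)"
        using elementary_functional_daugavet[OF assms False z d(1)] by blast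
      define F where "F = elementary_functional t f g"
      have F: "norm F \<le> 1"
        using norm_elementary_functional[OF assms(5), of f g] mult_mono[OF f g] by (simp add: F_def)
      have "\<bar>blinfun_apply F z\<bar> \<le> 1" using norm_blinfun[of F z] F z by simp
      then have near: "\<bar>blinfun_apply F z - 1\<bar> \<le> d" using slice by (simp add: F_def)
      \<comment> \<open>The adjoint of \<open>G + I\<close> maps \<open>F\<close> to \<open>F + F z * \<phi>\<close>, and \<open>F z\<close> is almost 1.\<close>
      have adjoint: "F o\<^sub>L (G + id_blinfun) = (\<phi> + F) + (blinfun_apply F z - 1) *\<^sub>R \<phi>"
        by (rule blinfun_eqI)
          (simp add: G blinfun.add_left blinfun.add_right blinfun.scaleR_left blinfun.scaleR_right
            algebra_simps)
      have "norm (\<phi> + F) - norm ((blinfun_apply F z - 1) *\<^sub>R \<phi>) \<le> norm (F o\<^sub>L (G + id_blinfun))"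
        unfolding adjoint by (rule norm_diff_ineq)
      moreover have "norm ((blinfun_apply F z - 1) *\<^sub>R \<phi>) \<le> d * norm \<phi>"
        using near by (simp add: mult_right_mono)
      moreover have "norm (F o\<^sub>L (G + id_blinfun)) \<le> norm (G + id_blinfun)"
        using norm_blinfun_compose[of F "G + id_blinfun"]
          mult_right_mono[OF F, of "norm (G + id_blinfun)"] by simp
      moreover have "d + d * norm \<phi> = e" using d(2) by (simp add: algebra_simps)
      ultimately show "norm \<phi> + 1 \<le> norm (G + id_blinfun) + e"
        using large by (simp add: F_def)
    qed
  qed
  ultimately show "1 + norm G \<le> norm (G + id_blinfun)" by linarith
qed

end
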